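(* Let $m$ be a positive integer and let $\psi$ be an even primitive Dirichlet character of modulus $m$. Then \begin{align*} L(1,\psi) &=\frac{2\tau(\psi)}{\pi i m^2}\sum_{d\mid m}\frac{d^2}{\varphi(d)} \sum_{\substack{\chi\in\hat{U}_d\\ \chi \text{ odd}}} \mathcal{B}_{-1}(\chi\overline{\psi})\,\tau(\overline{\chi})\,L(2,\chi)\\ &\quad+\frac{\tau(\psi)}{\pi^2 m^2}\sum_{d\mid m}\frac{d^3}{\varphi(d)} \sum_{\substack{\chi\in\hat{U}_d\\ \chi \text{ even}}} \mathcal{B}_{-2}(\chi\overline{\psi})\,\tau(\overline{\chi})\,L(3,\chi) -\frac{m\,\tau(\psi)}{\pi^2}\,\mathcal{B}_{-2}(\overline{\psi})\,\zeta(3)\\ &\quad-\frac{m\,\tau(\psi)}{2\pi^2}\sum_{n=1}^\infty \frac{1}{\binom{2n}{n}n^3}\sum_{0<a<m/2}\frac{\overline{\psi}(a)}{a^2} \left(2\sin\frac{\pi a}{m}\right)^{2n}. \end{align*}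
   Context: For a positive integer $d$, $\hat{U}_d$ denotes the group of Dirichlet characters of modulus $d$ (not necessarily primitive); $\chi$ is called even if $\chi(-1)=1$ and odd if $\chi(-1)=-1$. For $\chi\in\hat U_d$, $L(s,\chi)=\sum_{n\ge1}\chi(n)n^{-s}$, and the Gauss sum is $\tau(\chi)=\sum_{\nu \bmod d}\chi(\nu)e^{2\pi i\nu/d}$, computed with respect to the modulus $d$ of $\chi$. $\overline{\chi}$ is the complex conjugate (inverse) character. $\varphi$ is Euler's totient function and $\zeta$ the Riemann zeta function. For a Dirichlet character $\chi$ of modulus $m$ and an integer $j$, $\mathcal{B}_j(\chi):=\sum_{0<a<m/2}a^j\chi(a)$. For $d\mid m$ and $\chi\in\hat U_d$, the product $\chi\overline{\psi}$ is regarded as a character of modulus $m$, so $\mathcal{B}_j(\chi\overline\psi)=\sum_{0<a<m/2}a^j\chi(a)\overline\psi(a)$.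
   Formalization: The formal theorem assumes m > 1: for m = 1 the only character is trivial, which is even and primitive, and L(1,ψ) is the divergent harmonic series, so the formula has no meaning there. *)

theory Defs
  imports "HOL-Analysis.Analysis" "HOL-Number_Theory.Number_Theory"
begin

definition dirichlet_char :: "nat \<Rightarrow> (int \<Rightarrow> complex) \<Rightarrow> bool" where
  "dirichlet_char d \<theta> \<longleftrightarrow> d > 0 \<and> \<theta> 1 = 1 \<and>
     (\<forall>a b. \<theta> (a * b) = \<theta> a * \<theta> b) \<and>
     (\<forall>a. \<theta> (a + int d) = \<theta> a) \<and>
     (\<forall>a. \<theta> a = 0 \<longleftrightarrow> \<not> coprime a (int d))"

(* primitive: not induced by any character of a proper divisor modulus *)
definition primitive_char :: "nat \<Rightarrow> (int \<Rightarrow> complex) \<Rightarrow> bool" where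
  "primitive_char m \<theta> \<longleftrightarrow> dirichlet_char m \<theta> \<and>
     (\<forall>d. d dvd m \<and> d < m \<longrightarrow>
        (\<exists>a. coprime a (int m) \<and> [a = 1] (mod int d) \<and> \<theta> a \<noteq> 1))"

definition even_char :: "(int \<Rightarrow> complex) \<Rightarrow> bool" where
  "even_char \<theta> \<longleftrightarrow> \<theta> (-1) = 1"

definition odd_char :: "(int \<Rightarrow> complex) \<Rightarrow> bool" where
  "odd_char \<theta> \<longleftrightarrow> \<theta> (-1) = -1"

definition dirichlet_L :: "(int \<Rightarrow> complex) \<Rightarrow> nat \<Rightarrow> complex" where
  "dirichlet_L \<theta> s = (\<Sum>n. \<theta> (int (Suc n)) / of_nat (Suc n) ^ s)"

definition gauss_sum :: "nat \<Rightarrow> (int \<Rightarrow> complex) \<Rightarrow> complex" where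
  "gauss_sum d \<theta> = (\<Sum>\<nu><d. \<theta> (int \<nu>) * exp (2 * pi * \<i> * of_nat \<nu> / of_nat d))"

(* B_j(chi) = sum_{0<a<m/2} a^j chi(a), chi regarded as a character of modulus m *)
definition Bsum :: "nat \<Rightarrow> int \<Rightarrow> (int \<Rightarrow> complex) \<Rightarrow> complex" where
  "Bsum m j \<theta> = (\<Sum>a\<in>{a::int. 0 < a \<and> 2 * a < int m}. (of_int a) powi j * \<theta> a)"

definition zeta3 :: complex where
  "zeta3 = (\<Sum>n. 1 / of_nat (Suc n) ^ 3)"

end

(*
  Finite Fourier inversion for the primitive even character psi turns
  sum cos(n x)/n = - ln(2 sin(x/2)) into
  L(1,psi) = -(2 tau(psi)/m) sum_{0<a<m/2} conj psi(a) ln(2 sin(pi a/m)).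
  With Cl2(x) = sum sin(k x)/k^2 and Cl3(x) = sum cos(k x)/k^3, for 0 < t < pi/2,
    sum_{n>=1} (2 sin t)^(2n) / (binom(2n,n) n^3)
      = 4 t^2 ln(2 sin t) + 4 t Cl2(2t) + 2 Cl3(2t) - 2 zeta(3),
  because both sides have derivative 4 t^2 cot t (using sum (2 sin t)^(2n) / (binom(2n,n) n^2) = 2 t^2).
  Taking t = pi a/m, dividing by a^2 and summing against conj psi(a) expresses L(1,psi) through
  the values Cl2(2 pi a/m), Cl3(2 pi a/m).  Splitting those series according to gcd(k,m) = m/d and
  expanding e(n/d), for n coprime to d, in the characters modulo d produces the L(2,chi) and L(3,chi).
*)
theory Submission
  imports Defs "HOL-Real_Asymp.Real_Asymp"
begin

section \<open>Dirichlet characters\<close>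

text \<open>The logarithm carries the factor t^2, so at t = pi a/m the division by a^2 leaves a
  coefficient independent of a; this is what lets the weighted sum over a reproduce L(1,psi). Three
  obstacles shape the proof. The series sum cos(n x)/n converges only conditionally, so termwise
  integration rests on uniform convergence on [delta, pi], and the derivative of \<open>Cl2\<close>
  is obtained inside (0, pi). The logarithm is singular at t = 0, so the constant -2 zeta(3) comes
  from a one-sided limit and not from evaluation at a point. Expanding e(n/d) in characters needs
  the full orthogonality relations, which rest on characters that separate units. Primitivity of psi
  enters through the Gauss sum identity at arguments not coprime to m, where the exponential sum has
  to vanish. The chi are not reduced to primitive characters: the terms with gcd(k,m) = m/d involve
  just the integers prime to d, exactly where the characters modulo d are nonzero.\<close>

lemma periodic_int_cong:
  fixes f :: "int \<Rightarrow> 'a"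
  assumes per: "\<And>a. f (a + p) = f a" and "[a = b] (mod p)"
  shows "f a = f b"
proof -
  have *: "f (x + p * int n) = f x" for x n
  proof (induction n)
    case (Suc n)
    have "f (x + p * int (Suc n)) = f ((x + p * int n) + p)"
      by (simp add: algebra_simps)
    then show ?case using Suc by (simp add: per)
  qed simp
  obtain k where "b = a + p * k"
    using assms(2) by (auto simp: cong_iff_lin)
  then show ?thesis
    using *[of a "nat k"] *[of b "nat (-k)"] by (cases "k \<ge> 0") auto
qed

text \<open>Multiplication by \<open>b\<close> permutes the residues modulo \<open>d\<close>. This
  is the substitution used to compare a character sum with a multiple of itself.\<close>

lemma sum_residues_mult_unit:
  fixes f :: "int \<Rightarrow> 'a::comm_monoid_add"
  assumes per: "\<And>a. f (a + int d) = f a" and cop: "coprime b (int d)"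
  shows "(\<Sum>\<nu><d. f (b * int \<nu>)) = (\<Sum>\<nu><d. f (int \<nu>))"
proof (cases "d = 0")
  case False
  define g where "g \<nu> = nat ((b * int \<nu>) mod int d)" for \<nu>
  have g: "int (g \<nu>) = (b * int \<nu>) mod int d" for \<nu>
    using False by (simp add: g_def)
  have "inj_on g {..<d}"
  proof (rule inj_onI)
    fix x y assume xy: "x \<in> {..<d}" "y \<in> {..<d}" "g x = g y"
    then have "[b * int x = b * int y] (mod int d)"
      unfolding cong_def by (metis g)
    then have "[int x = int y] (mod int d)"
      using cop by (simp add: cong_mult_lcancel)
    then show "x = y"
      using xy by (simp add: cong_def)
  qed
  moreover have "g ` {..<d} \<subseteq> {..<d}"
    using False by (auto simp: g_def nat_less_iff)
  ultimately have "bij_betw g {..<d} {..<d}"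
    by (simp add: bij_betw_def endo_inj_surj)
  then have "(\<Sum>\<nu><d. f (int (g \<nu>))) = (\<Sum>\<nu><d. f (int \<nu>))"
    by (rule sum.reindex_bij_betw)
  moreover have "f (int (g \<nu>)) = f (b * int \<nu>)" for \<nu>
    unfolding g by (rule periodic_int_cong[where f = f and p = "int d"]) (simp_all add: per)
  ultimately show ?thesis by simp
qed simp

lemma euler_theorem_int:
  assumes "d > 0" "coprime a (int d)"
  shows "[a ^ totient d = 1] (mod int d)"
proof -
  define b where "b = nat (a mod int d)"
  have b: "int b = a mod int d"
    using assms by (simp add: b_def)
  then have "coprime (int b) (int d)"
    using assms by simp
  then have "[b ^ totient d = 1] (mod d)"
    by (intro euler_theorem) simp
  then have "[int b ^ totient d = 1] (mod int d)"
    by (metis cong_int_iff of_nat_1 of_nat_power)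
  moreover have "[int b ^ totient d = a ^ totient d] (mod int d)"
    by (intro cong_pow) (simp add: b)
  ultimately show ?thesis
    by (metis cong_sym cong_trans)
qed

section \<open>Additive characters\<close>

text \<open>This is e(n/d). It occurs with modulus \<open>d\<close> in Gauss sums and with modulus
  \<open>totient d\<close> as a supply of roots of unity for eigenvalues.\<close>

definition add_char :: "nat \<Rightarrow> int \<Rightarrow> complex" where
  "add_char d n = cis (2 * pi * of_int n / of_nat d)"

lemma add_char_0 [simp]: "add_char d 0 = 1"
  by (simp add: add_char_def)

lemma add_char_add: "add_char d (a + b) = add_char d a * add_char d b"
  by (simp add: add_char_def cis_mult add_divide_distrib ring_distribs)

lemma add_char_power: "add_char d a ^ n = add_char d (a * int n)"
  by (induction n) (simp_all add: add_char_add ring_distribs)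

lemma add_char_eq_1_iff:
  assumes "d > 0"
  shows "add_char d a = 1 \<longleftrightarrow> int d dvd a"
proof
  assume "add_char d a = 1"
  then have "cos (2 * pi * of_int a / of_nat d) = 1"
    unfolding add_char_def complex_eq_iff by simp
  then obtain n :: int where "2 * pi * of_int a / of_nat d = of_int n * 2 * pi"
    unfolding cos_one_2pi_int by blast
  then have "real_of_int a = real_of_int (n * int d)"
    using assms by (simp add: field_simps)
  then have "a = n * int d"
    by linarith
  then show "int d dvd a" by simp
next
  assume "int d dvd a"
  then obtain k where "a = int d * k" by blast
  then show "add_char d a = 1"
    using assms cis_multiple_2pi[of "of_int k"] by (simp add: add_char_def mult.assoc)
qed

lemma add_char_periodic: "d > 0 \<Longrightarrow> add_char d (a + int d) = add_char d a"
  by (simp add: add_char_add add_char_eq_1_iff)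

lemma add_char_cong: "d > 0 \<Longrightarrow> [a = b] (mod int d) \<Longrightarrow> add_char d a = add_char d b"
  by (rule periodic_int_cong[of "add_char d"]) (auto simp: add_char_periodic)

text \<open>A geometric sum whose ratio \<open>add_char d a\<close> has \<open>d\<close>-th power
  1.\<close>

lemma sum_add_char:
  assumes "d > 0"
  shows "(\<Sum>\<nu><d. add_char d (a * int \<nu>)) = (if int d dvd a then of_nat d else 0)"
proof -
  have "(\<Sum>\<nu><d. add_char d (a * int \<nu>)) = (\<Sum>\<nu><d. add_char d a ^ \<nu>)"
    by (simp add: add_char_power)
  moreover have "add_char d a ^ d = 1"
    using assms by (simp add: add_char_power add_char_eq_1_iff)
  ultimately show ?thesis
    using assms by (cases "int d dvd a") (simp_all add: geometric_sum flip: add_char_eq_1_iff)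
qed

lemma gauss_sum_add_char: "gauss_sum d \<theta> = (\<Sum>\<nu><d. \<theta> (int \<nu>) * add_char d (int \<nu>))"
  by (simp add: gauss_sum_def add_char_def cis_conv_exp mult_ac)

section \<open>Basic properties of Dirichlet characters\<close>

context
  fixes d :: nat and \<theta> :: "int \<Rightarrow> complex"
  assumes char: "dirichlet_char d \<theta>"
begin

lemma dirichlet_char_pos: "d > 0"
  and dirichlet_char_1: "\<theta> 1 = 1"
  and dirichlet_char_mult: "\<theta> (a * b) = \<theta> a * \<theta> b"
  and dirichlet_char_periodic: "\<theta> (a + int d) = \<theta> a"
  and dirichlet_char_eq_0_iff: "\<theta> a = 0 \<longleftrightarrow> \<not> coprime a (int d)"
  using char unfolding dirichlet_char_def by auto

lemma dirichlet_char_cong: "[a = b] (mod int d) \<Longrightarrow> \<theta> a = \<theta> b"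
  by (rule periodic_int_cong[of \<theta>]) (auto simp: dirichlet_char_periodic)

lemma dirichlet_char_power: "\<theta> (a ^ n) = \<theta> a ^ n"
  by (induction n) (simp_all add: dirichlet_char_1 dirichlet_char_mult)

lemma dirichlet_char_power_totient: "coprime a (int d) \<Longrightarrow> \<theta> a ^ totient d = 1"
  using dirichlet_char_cong[OF euler_theorem_int[OF dirichlet_char_pos]]
  by (simp add: dirichlet_char_power dirichlet_char_1)

text \<open>By Euler's theorem the value at a unit is a root of unity.\<close>

lemma norm_dirichlet_char:
  "norm (\<theta> a) = (if coprime a (int d) then 1 else 0)"
proof (cases "coprime a (int d)")
  case True
  have "norm (\<theta> a) ^ totient d = 1"
    using dirichlet_char_power_totient[OF True] by (metis norm_one norm_power)
  then have "norm (\<theta> a) = 1"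
    using dirichlet_char_pos power_eq_imp_eq_base[of "norm (\<theta> a)" "totient d" 1] by simp
  then show ?thesis using True by simp
qed (use dirichlet_char_eq_0_iff in auto)

lemma norm_dirichlet_char_le: "norm (\<theta> a) \<le> 1"
  by (simp add: norm_dirichlet_char)

lemma cnj_dirichlet_char_mult_self: "coprime a (int d) \<Longrightarrow> cnj (\<theta> a) * \<theta> a = 1"
  using norm_dirichlet_char[of a] complex_norm_square[of "\<theta> a"] by (simp add: mult.commute)

lemma dirichlet_char_cnj: "dirichlet_char d (\<lambda>a. cnj (\<theta> a))"
  using char unfolding dirichlet_char_def by simp

end

lemma dirichlet_char_times:
  assumes "dirichlet_char d \<theta>" "dirichlet_char d \<eta>"
  shows "dirichlet_char d (\<lambda>a. \<theta> a * \<eta> a)"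
  using assms unfolding dirichlet_char_def by auto

text \<open>A character is determined by its values on one period, and each of these is 0 or a root
  of unity with exponent \<open>totient d\<close>.\<close>

lemma finite_dirichlet_chars: "finite {\<theta>. dirichlet_char d \<theta>}"
proof (cases "d = 0")
  case True
  then show ?thesis by (simp add: dirichlet_char_def)
next
  case False
  define V where "V = insert 0 {z::complex. z ^ totient d = 1}"
  have "finite V"
    using False by (auto simp: V_def intro: finite_roots_unity)
  moreover have "inj_on (\<lambda>\<theta>. restrict \<theta> {0..<int d}) {\<theta>. dirichlet_char d \<theta>}"
  proof (rule inj_onI, clarsimp, rule ext)
    fix \<theta> \<eta> x
    assume *: "dirichlet_char d \<theta>" "dirichlet_char d \<eta>"
      "restrict \<theta> {0..<int d} = restrict \<eta> {0..<int d}"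
    have "\<theta> (x mod int d) = \<eta> (x mod int d)"
      using False fun_cong[OF *(3), of "x mod int d"] by simp
    then show "\<theta> x = \<eta> x"
      using dirichlet_char_cong[OF *(1), of "x mod int d" x]
        dirichlet_char_cong[OF *(2), of "x mod int d" x] by simp
  qed
  moreover have "(\<lambda>\<theta>. restrict \<theta> {0..<int d}) ` {\<theta>. dirichlet_char d \<theta>} \<subseteq> PiE {0..<int d} (\<lambda>_. V)"
    using dirichlet_char_power_totient dirichlet_char_eq_0_iff by (fastforce simp: V_def)
  ultimately show ?thesis
    by (meson finite_PiE finite_atLeastLessThan_int finite_imageD finite_subset)
qed

section \<open>Existence of characters separating units\<close>

definition eigenfun :: "(int \<Rightarrow> complex) \<Rightarrow> int \<Rightarrow> complex \<Rightarrow> bool" where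
  "eigenfun f g ev \<longleftrightarrow> (\<forall>x. f (g * x) = ev * f x)"

text \<open>When the operator taking f to f(g x) has N-th power 1, this is N times the projection of
  f onto its eigenspace for e(j/N); dropping 1/N avoids divisions.\<close>

definition eigen_component :: "nat \<Rightarrow> int \<Rightarrow> nat \<Rightarrow> (int \<Rightarrow> complex) \<Rightarrow> int \<Rightarrow> complex" where
  "eigen_component N g j f x = (\<Sum>k<N. add_char N (- (int j * int k)) * f (g ^ k * x))"

text \<open>Replacing x by g x shifts the index \<open>k\<close> by one, and the sum wraps around
  because both factors have period \<open>N\<close> in \<open>k\<close>.\<close>

lemma eigenfun_eigen_component:
  assumes "N > 0" "\<And>x. f (g ^ N * x) = f x"
  shows "eigenfun (eigen_component N g j f) g (add_char N (int j))"
  unfolding eigenfun_def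
proof
  fix x
  define u where "u k = add_char N (- (int j * int k)) * f (g ^ k * x)" for k
  have "u N = u 0"
    using assms add_char_eq_1_iff[of N "- (int j * int N)"] by (simp add: u_def)
  then have "(\<Sum>k<N. u (Suc k)) = (\<Sum>k<N. u k)"
    using sum.lessThan_Suc_shift[of u N] sum.lessThan_Suc[of u N] by (simp add: add.commute)
  moreover have "add_char N (- (int j * int k)) * f (g ^ k * (g * x)) = add_char N (int j) * u (Suc k)" for k
  proof -
    have "add_char N (- (int j * int k)) = add_char N (int j) * add_char N (- (int j * int (Suc k)))"
      by (simp add: algebra_simps flip: add_char_add)
    then show ?thesis by (simp add: u_def mult_ac)
  qed
  ultimately show "eigen_component N g j f (g * x) = add_char N (int j) * eigen_component N g j f x"
    unfolding eigen_component_def by (simp add: sum_distrib_left[symmetric] u_def)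
qed

text \<open>The operators for \<open>g\<close> and \<open>h\<close> commute, so splitting along
  \<open>g\<close> keeps the eigenvalues already obtained.\<close>

lemma eigenfun_eigen_component_other:
  assumes "eigenfun f h ev"
  shows "eigenfun (eigen_component N g j f) h ev"
  unfolding eigenfun_def
proof
  fix x
  have "f (g ^ k * (h * x)) = ev * f (g ^ k * x)" for k
    using assms unfolding eigenfun_def by (metis mult.left_commute)
  then show "eigen_component N g j f (h * x) = ev * eigen_component N g j f x"
    by (simp add: eigen_component_def sum_distrib_left mult_ac)
qed

text \<open>Summation over \<open>j\<close> kills every \<open>k\<close> except 0. Consequently a
  function that is nonzero at \<open>x\<close> has a component that is nonzero at the same
  \<open>x\<close>.\<close>

lemma sum_eigen_component:
  assumes "N > 0"
  shows "(\<Sum>j<N. eigen_component N g j f x) = of_nat N * f x"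
proof -
  have "(\<Sum>j<N. eigen_component N g j f x)
      = (\<Sum>k<N. f (g ^ k * x) * (\<Sum>j<N. add_char N (- int k * int j)))"
    unfolding eigen_component_def
    by (subst sum.swap) (simp add: sum_distrib_left mult_ac)
  also have "\<dots> = (\<Sum>k<N. if k = 0 then of_nat N * f x else 0)"
  proof (rule sum.cong)
    fix k assume "k \<in> {..<N}"
    then have "int N dvd - int k \<longleftrightarrow> k = 0"
      by (auto dest: zdvd_imp_le)
    then show "f (g ^ k * x) * (\<Sum>j<N. add_char N (- int k * int j)) = (if k = 0 then of_nat N * f x else 0)"
      using sum_add_char[OF assms, of "- int k"] by simp
  qed simp
  finally show ?thesis using assms by simp
qed

text \<open>These are the functions on the group of units modulo \<open>d\<close>, extended by zero
  to all integers.\<close>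

definition unit_fun :: "nat \<Rightarrow> (int \<Rightarrow> complex) \<Rightarrow> bool" where
  "unit_fun d f \<longleftrightarrow> (\<forall>x. f (x + int d) = f x) \<and> (\<forall>x. \<not> coprime x (int d) \<longrightarrow> f x = 0)"

lemma unit_fun_cong:
  assumes "unit_fun d f" "[a = b] (mod int d)"
  shows "f a = f b"
  by (rule periodic_int_cong[OF _ assms(2)]) (use assms(1) in \<open>simp add: unit_fun_def\<close>)

lemma unit_fun_power_totient:
  assumes "unit_fun d f" "coprime g (int d)" "d > 0"
  shows "f (g ^ totient d * x) = f x"
proof -
  have "[g ^ totient d * x = 1 * x] (mod int d)"
    by (intro cong_mult cong_refl euler_theorem_int assms)
  from unit_fun_cong[OF assms(1) this] show ?thesis by simp
qed

lemma unit_fun_eigen_component: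
  assumes "unit_fun d f"
  shows "unit_fun d (eigen_component N g j f)"
proof -
  have "f (g ^ k * (x + int d)) = f (g ^ k * x)" for k x
    by (rule unit_fun_cong[OF assms]) (simp add: cong_def distrib_left)
  then show ?thesis
    using assms by (auto simp: unit_fun_def eigen_component_def intro!: sum.neutral)
qed

text \<open>
  The operators $f \mapsto f(g\,\cdot)$, $g$ a unit, commute and have order dividing $\varphi(d)$, so
  splitting a function repeatedly into eigencomponents ends at a nonzero simultaneous eigenfunction;
  normalised at 1 it is a Dirichlet character.  This replaces the extension of characters from
  subgroups in the proof that characters separate units.
\<close>

lemma simultaneous_eigenfun:
  assumes "d > 0" "finite S" "\<forall>g\<in>S. coprime g (int d)"
    and "unit_fun d f0" "eigenfun f0 a ev0" "f0 x0 \<noteq> 0"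
  shows "\<exists>f x. unit_fun d f \<and> f x \<noteq> 0 \<and> eigenfun f a ev0 \<and> (\<forall>g\<in>S. \<exists>ev. eigenfun f g ev)"
  using assms(2,3)
proof (induction S)
  case empty
  then show ?case using assms by blast
next
  case (insert g S)
  then obtain f x where f: "unit_fun d f" "f x \<noteq> 0" "eigenfun f a ev0" "\<forall>g\<in>S. \<exists>ev. eigenfun f g ev"
    by auto
  let ?N = "totient d"
  have "?N > 0" using assms(1) by simp
  then obtain j where "eigen_component ?N g j f x \<noteq> 0"
    using sum_eigen_component[of ?N g f x] f(2) by (metis (no_types, lifting) mult_eq_0_iff of_nat_eq_0_iff less_irrefl sum.neutral)
  moreover have "eigenfun (eigen_component ?N g j f) g (add_char ?N (int j))"
    using insert.prems assms(1) f(1) \<open>?N > 0\<close> by (intro eigenfun_eigen_component unit_fun_power_totient) auto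
  ultimately show ?case
    using f by (intro exI[of _ "eigen_component ?N g j f"] exI[of _ x])
      (auto intro: unit_fun_eigen_component eigenfun_eigen_component_other)
qed

text \<open>Comparing the eigenvalue equation of \<open>g\<close> at \<open>y\<close> and at 1
  eliminates the eigenvalue and gives \<open>f (g * y) * f 1 = f g * f y\<close>, which is
  multiplicativity after division by \<open>f 1\<close>.\<close>

lemma dirichlet_char_of_eigenfun:
  assumes "d > 0" "unit_fun d f" "f x \<noteq> 0"
    and eig: "\<And>g. coprime g (int d) \<Longrightarrow> \<exists>ev. eigenfun f g ev"
  shows "dirichlet_char d (\<lambda>y. f y / f 1)"
proof -
  have cx: "coprime x (int d)" using assms(2,3) unfolding unit_fun_def by blast
  have mult1: "f (g * y) * f 1 = f g * f y" if "coprime g (int d)" for g y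
  proof -
    obtain l where "eigenfun f g l" using eig[OF \<open>coprime g (int d)\<close>] by blast
    then have "f (g * y) = l * f y" "f (g * 1) = l * f 1" unfolding eigenfun_def by blast+
    then show ?thesis by simp
  qed
  have nz1: "f 1 \<noteq> 0"
  proof
    assume "f 1 = 0"
    obtain l where "eigenfun f x l" using eig[OF cx] by blast
    then have "f (x * 1) = l * f 1" unfolding eigenfun_def by blast
    then show False using \<open>f 1 = 0\<close> assms(3) by simp
  qed
  \<comment> \<open>A zero at a unit \<open>g\<close> would spread to all multiples of
    \<open>g\<close>, among them \<open>g ^ totient d\<close>, where \<open>f\<close> takes the
    value \<open>f 1\<close>.\<close>
  have nz: "f g \<noteq> 0" if "coprime g (int d)" for g
  proof
    assume g0: "f g = 0"
    have "f (g * y) = 0" for y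
      using mult1[OF \<open>coprime g (int d)\<close>, of y] g0 nz1 by simp
    moreover have "g ^ totient d * 1 = g * g ^ (totient d - 1)"
      using assms(1) by (simp flip: power_Suc)
    ultimately show False
      using unit_fun_power_totient[OF assms(2) \<open>coprime g (int d)\<close> assms(1), of 1] nz1 by simp
  qed
  have "f (a * b) / f 1 = f a / f 1 * (f b / f 1)" for a b
  proof (cases "coprime a (int d)")
    case True
    then show ?thesis using mult1[of a b] nz1 by (simp add: field_simps)
  next
    case False
    then show ?thesis using assms(2) by (simp add: unit_fun_def)
  qed
  then show ?thesis
    using assms(1,2) nz1 nz unfolding dirichlet_char_def unit_fun_def by auto
qed

text \<open>The indicator of the class of 1 is not invariant under multiplication by
  \<open>a\<close>, so it has a nonzero component with eigenvalue other than 1. Refined to a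
  simultaneous eigenfunction and normalised at 1, this takes that eigenvalue at
  \<open>a\<close>.\<close>

lemma dirichlet_char_separates:
  assumes "d > 0" "coprime a (int d)" "\<not> [a = 1] (mod int d)"
  obtains \<theta> where "dirichlet_char d \<theta>" "\<theta> a \<noteq> 1"
proof -
  define \<delta> :: "int \<Rightarrow> complex" where "\<delta> x = (if [x = 1] (mod int d) then 1 else 0)" for x
  have u: "unit_fun d \<delta>"
    unfolding unit_fun_def
  proof (intro conjI allI impI)
    fix x
    show "\<delta> (x + int d) = \<delta> x" by (simp add: \<delta>_def cong_def)
    assume "\<not> coprime x (int d)"
    then show "\<delta> x = 0"
      using cong_imp_coprime[of 1 x "int d"] by (auto simp: \<delta>_def cong_sym_eq)
  qed
  let ?N = "totient d"
  have N: "?N > 0" using assms(1) by simp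
  \<comment> \<open>If all components with eigenvalue different from 1 vanished, the others, being
    invariant under \<open>a\<close>, would force \<open>\<delta> a = \<delta> 1\<close>.\<close>
  have "\<exists>j<?N. \<exists>x. add_char ?N (int j) \<noteq> 1 \<and> eigen_component ?N a j \<delta> x \<noteq> 0"
  proof (rule ccontr)
    assume *: "\<not> ?thesis"
    have "eigen_component ?N a j \<delta> (a * x) = eigen_component ?N a j \<delta> x" if "j < ?N" for j x
    proof (cases "add_char ?N (int j) = 1")
      case True
      then show ?thesis
        using eigenfun_eigen_component[of ?N \<delta> a j] N u assms by (simp add: eigenfun_def unit_fun_power_totient)
    next
      case False
      then show ?thesis using * that by metis
    qed
    then have "(\<Sum>j<?N. eigen_component ?N a j \<delta> (a * 1)) = (\<Sum>j<?N. eigen_component ?N a j \<delta> 1)"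
      by (intro sum.cong refl) blast
    then have "of_nat ?N * \<delta> (a * 1) = of_nat ?N * \<delta> 1"
      by (simp only: sum_eigen_component[OF N])
    then show False using N assms(3) by (simp add: \<delta>_def)
  qed
  then obtain j x where jx: "j < ?N" "add_char ?N (int j) \<noteq> 1" "eigen_component ?N a j \<delta> x \<noteq> 0"
    by blast
  have "unit_fun d (eigen_component ?N a j \<delta>)"
    by (rule unit_fun_eigen_component[OF u])
  moreover have "eigenfun (eigen_component ?N a j \<delta>) a (add_char ?N (int j))"
    using N u assms by (intro eigenfun_eigen_component unit_fun_power_totient) auto
  moreover have "finite {g\<in>{0..<int d}. coprime g (int d)}"
    by (rule finite_subset[of _ "{0..<int d}"]) auto
  ultimately obtain f y where f: "unit_fun d f" "f y \<noteq> 0" "eigenfun f a (add_char ?N (int j))"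
    "\<forall>g\<in>{g\<in>{0..<int d}. coprime g (int d)}. \<exists>ev. eigenfun f g ev"
    using simultaneous_eigenfun[of d "{g\<in>{0..<int d}. coprime g (int d)}" "eigen_component ?N a j \<delta>" a "add_char ?N (int j)" x]
      jx(3) assms(1) by blast
  have eig: "\<exists>ev. eigenfun f g ev" if "coprime g (int d)" for g
  proof -
    have "g mod int d \<in> {g\<in>{0..<int d}. coprime g (int d)}"
      using that assms(1) by simp
    then obtain l where "eigenfun f (g mod int d) l" using f(4) by blast
    moreover have "f ((g mod int d) * z) = f (g * z)" for z
      by (rule unit_fun_cong[OF f(1)]) (simp add: cong_def mod_mult_left_eq)
    ultimately have "eigenfun f g l"
      unfolding eigenfun_def by metis
    then show ?thesis ..
  qed
  have char: "dirichlet_char d (\<lambda>y. f y / f 1)"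
    by (rule dirichlet_char_of_eigenfun[OF assms(1) f(1,2) eig])
  then have "f 1 \<noteq> 0" by (auto simp: dirichlet_char_def)
  moreover have "f (a * 1) = add_char ?N (int j) * f 1"
    using f(3) unfolding eigenfun_def by blast
  ultimately have "f a / f 1 \<noteq> 1"
    using jx(2) by simp
  with char that show ?thesis by blast
qed

abbreviation dirichlet_chars :: "nat \<Rightarrow> (int \<Rightarrow> complex) set" where
  "dirichlet_chars d \<equiv> {\<theta>. dirichlet_char d \<theta>}"

text \<open>At units \<open>\<eta>\<close> can be cancelled and elsewhere all characters vanish;
  finiteness turns injectivity into surjectivity.\<close>

lemma bij_betw_times_dirichlet_char:
  assumes "dirichlet_char d \<eta>"
  shows "bij_betw (\<lambda>\<theta> a. \<eta> a * \<theta> a) (dirichlet_chars d) (dirichlet_chars d)"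
proof -
  have inj: "inj_on (\<lambda>\<theta> a. \<eta> a * \<theta> a) (dirichlet_chars d)"
  proof (rule inj_onI, rule ext)
    fix \<theta> \<theta>' a
    assume *: "\<theta> \<in> dirichlet_chars d" "\<theta>' \<in> dirichlet_chars d" "(\<lambda>a. \<eta> a * \<theta> a) = (\<lambda>a. \<eta> a * \<theta>' a)"
    then have "\<eta> a * \<theta> a = \<eta> a * \<theta>' a" by metis
    then show "\<theta> a = \<theta>' a"
      using *(1,2) dirichlet_char_eq_0_iff[OF assms, of a] dirichlet_char_eq_0_iff[of d \<theta> a]
        dirichlet_char_eq_0_iff[of d \<theta>' a] by (cases "coprime a (int d)") auto
  qed
  have "(\<lambda>\<theta> a. \<eta> a * \<theta> a) ` dirichlet_chars d \<subseteq> dirichlet_chars d"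
    using assms dirichlet_char_times by auto
  with inj show ?thesis
    by (simp add: bij_betw_def endo_inj_surj finite_dirichlet_chars)
qed

section \<open>Orthogonality relations\<close>

definition principal_char :: "nat \<Rightarrow> int \<Rightarrow> complex" where
  "principal_char d a = (if coprime a (int d) then 1 else 0)"

lemma dirichlet_char_principal: "d > 0 \<Longrightarrow> dirichlet_char d (principal_char d)"
proof -
  have "coprime (a + int d) (int d) \<longleftrightarrow> coprime a (int d)" for a
    by (simp add: coprime_iff_gcd_eq_1)
  moreover assume "d > 0"
  ultimately show ?thesis
    unfolding dirichlet_char_def principal_char_def by simp
qed

text \<open>For a character other than the principal one, a unit \<open>b\<close> with
  \<open>\<theta> b \<noteq> 1\<close> makes the sum equal to \<open>\<theta> b\<close> times
  itself.\<close>

lemma sum_dirichlet_char_residues: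
  assumes "dirichlet_char d \<theta>"
  shows "(\<Sum>\<nu><d. \<theta> (int \<nu>)) = (if \<theta> = principal_char d then of_nat (totient d) else 0)"
proof (cases "\<theta> = principal_char d")
  case True
  have "card {\<nu>\<in>{..<d}. coprime \<nu> d} = totient d"
  \<comment> \<open>For \<open>d = 1\<close> the unit is represented by 0 below \<open>d\<close>,
    but by 1 among the totatives.\<close>
  proof (cases "d = 1")
    case True
    then have "{\<nu>\<in>{..<d}. coprime \<nu> d} = {0}" by auto
    then show ?thesis using True by simp
  next
    case False
    have "{\<nu>\<in>{..<d}. coprime \<nu> d} = totatives d"
      using False by (auto simp: in_totatives_iff le_less intro!: Nat.gr0I)
    then show ?thesis by (simp add: totient_def)
  qed
  then show ?thesis
    using True by (simp add: principal_char_def sum.If_cases Int_def)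
next
  case False
  then obtain b where b: "\<theta> b \<noteq> principal_char d b" by blast
  then have cop: "coprime b (int d)"
    using dirichlet_char_eq_0_iff[OF assms, of b] by (auto simp: principal_char_def split: if_splits)
  with b have "\<theta> b \<noteq> 1" by (simp add: principal_char_def)
  have "(\<Sum>\<nu><d. \<theta> (b * int \<nu>)) = (\<Sum>\<nu><d. \<theta> (int \<nu>))"
    by (rule sum_residues_mult_unit) (use cop dirichlet_char_periodic[OF assms] in auto)
  then have "\<theta> b * (\<Sum>\<nu><d. \<theta> (int \<nu>)) = (\<Sum>\<nu><d. \<theta> (int \<nu>))"
    by (simp add: dirichlet_char_mult[OF assms] sum_distrib_left)
  then show ?thesis using \<open>\<theta> b \<noteq> 1\<close> False by auto
qed

text \<open>Away from 1 a separating character \<open>\<eta>\<close> makes the sum equal to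
  \<open>\<eta> a\<close> times itself. The value at 1, the number of characters, results from
  summing over all residues as well: on one side just the class of 1 survives, on the other just the
  principal character.\<close>

lemma sum_dirichlet_chars:
  assumes "d > 0"
  shows "(\<Sum>\<theta>\<in>dirichlet_chars d. \<theta> a) = (if [a = 1] (mod int d) then of_nat (totient d) else 0)"
proof -
  define S where "S a = (\<Sum>\<theta>\<in>dirichlet_chars d. \<theta> a)" for a
  have S0: "S a = 0" if ne: "\<not> [a = 1] (mod int d)" for a
  proof (cases "coprime a (int d)")
    case True
    then obtain \<eta> where \<eta>: "dirichlet_char d \<eta>" "\<eta> a \<noteq> 1"
      using dirichlet_char_separates[OF assms _ ne] by blast
    have "\<eta> a * S a = S a"
      using sum.reindex_bij_betw[OF bij_betw_times_dirichlet_char[OF \<eta>(1)], of "\<lambda>\<theta>. \<theta> a"]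
      by (simp add: S_def sum_distrib_left)
    then show ?thesis using \<eta>(2) by auto
  next
    case False
    then show ?thesis by (auto simp: S_def dirichlet_char_eq_0_iff intro!: sum.neutral)
  qed
  have S1: "S a = S 1" if "[a = 1] (mod int d)" for a
    unfolding S_def using that dirichlet_char_cong by (intro sum.cong) blast+
  have "S 1 = (\<Sum>\<nu><d. S (int \<nu>))"
  proof -
    \<comment> \<open>The representative \<open>1 mod d\<close> also covers \<open>d = 1\<close>,
      where it is 0.\<close>
    have one: "[int (1 mod d) = 1] (mod int d)"
      by (metis cong_int_iff cong_mod_left cong_refl of_nat_1)
    have "(\<Sum>\<nu><d. S (int \<nu>)) = (\<Sum>\<nu><d. if \<nu> = 1 mod d then S 1 else 0)"
    proof (rule sum.cong)
      fix \<nu> assume "\<nu> \<in> {..<d}"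
      then have "[int \<nu> = 1] (mod int d) \<longleftrightarrow> \<nu> = 1 mod d"
        by (metis cong_def cong_int_iff lessThan_iff mod_less of_nat_1)
      then show "S (int \<nu>) = (if \<nu> = 1 mod d then S 1 else 0)"
        using S0[of "int \<nu>"] S1[of "int \<nu>"] by presburger
    qed simp
    then show ?thesis using assms by simp
  qed
  also have "\<dots> = (\<Sum>\<theta>\<in>dirichlet_chars d. \<Sum>\<nu><d. \<theta> (int \<nu>))"
    unfolding S_def by (rule sum.swap)
  also have "\<dots> = (\<Sum>\<theta>\<in>dirichlet_chars d. if \<theta> = principal_char d then of_nat (totient d) else 0)"
    by (intro sum.cong) (simp_all add: sum_dirichlet_char_residues)
  also have "\<dots> = of_nat (totient d)"
    using finite_dirichlet_chars dirichlet_char_principal[OF assms] by simp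
  finally show ?thesis using S0[of a] S1[of a] unfolding S_def by presburger
qed

text \<open>On units conjugation is inversion, so \<open>cnj (\<theta> b)\<close> is the value of
  \<open>\<theta>\<close> at an inverse \<open>c\<close> of \<open>b\<close>, and the sum becomes
  the one over \<open>\<theta> (c * a)\<close>.\<close>

lemma sum_dirichlet_chars_orthogonal:
  assumes "d > 0" "coprime b (int d)"
  shows "(\<Sum>\<theta>\<in>dirichlet_chars d. cnj (\<theta> b) * \<theta> a)
     = (if [a = b] (mod int d) then of_nat (totient d) else 0)"
proof -
  obtain c where c: "[b * c = 1] (mod int d)"
    using cong_solve_coprime_int[OF assms(2)] by blast
  have "cnj (\<theta> b) = \<theta> c" if "dirichlet_char d \<theta>" for \<theta>
  proof -
    have "\<theta> b * \<theta> c = 1"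
      using dirichlet_char_cong[OF that c] that by (simp add: dirichlet_char_mult dirichlet_char_1)
    moreover have "cnj (\<theta> b) * \<theta> b = 1"
      by (rule cnj_dirichlet_char_mult_self[OF that assms(2)])
    ultimately show ?thesis
      by (metis mult.assoc mult.commute mult_1)
  qed
  then have "(\<Sum>\<theta>\<in>dirichlet_chars d. cnj (\<theta> b) * \<theta> a) = (\<Sum>\<theta>\<in>dirichlet_chars d. \<theta> (c * a))"
    by (intro sum.cong) (simp_all add: dirichlet_char_mult)
  moreover have "[c * a = 1] (mod int d) \<longleftrightarrow> [a = b] (mod int d)"
  proof
    assume "[c * a = 1] (mod int d)"
    then have "[b * (c * a) = b * 1] (mod int d)" by (intro cong_mult cong_refl)
    moreover have "[b * c * a = 1 * a] (mod int d)" using c by (intro cong_mult cong_refl)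
    ultimately show "[a = b] (mod int d)"
      by (simp add: mult.assoc) (metis cong_sym cong_trans)
  next
    assume "[a = b] (mod int d)"
    then have "[c * a = c * b] (mod int d)" by (intro cong_mult cong_refl)
    then show "[c * a = 1] (mod int d)" using c by (metis cong_trans mult.commute)
  qed
  ultimately show ?thesis using sum_dirichlet_chars[OF assms(1)] by simp
qed

text \<open>Fourier inversion on the unit group: opening the Gauss sums and exchanging the
  summations leaves the single residue of \<open>n\<close>.\<close>

lemma sum_gauss_sum_dirichlet_chars:
  assumes "d > 0"
  shows "(\<Sum>\<theta>\<in>dirichlet_chars d. gauss_sum d (\<lambda>a. cnj (\<theta> a)) * \<theta> n)
     = (if coprime n (int d) then of_nat (totient d) * add_char d n else 0)"
proof (cases "coprime n (int d)")
  case False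
  then show ?thesis by (auto simp: dirichlet_char_eq_0_iff intro!: sum.neutral)
next
  case True
  define r where "r = nat (n mod int d)"
  have r: "int r = n mod int d" "r < d" using assms by (auto simp: r_def nat_less_iff)
  have "(\<Sum>\<theta>\<in>dirichlet_chars d. gauss_sum d (\<lambda>a. cnj (\<theta> a)) * \<theta> n)
     = (\<Sum>\<nu><d. add_char d (int \<nu>) * (\<Sum>\<theta>\<in>dirichlet_chars d. cnj (\<theta> (int \<nu>)) * \<theta> n))"
    unfolding gauss_sum_add_char sum_distrib_left sum_distrib_right
    by (subst sum.swap) (simp add: mult_ac)
  also have "\<dots> = (\<Sum>\<nu><d. if \<nu> = r then of_nat (totient d) * add_char d n else 0)"
  proof (rule sum.cong)
    fix \<nu> assume \<nu>: "\<nu> \<in> {..<d}"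
    then have eq: "[n = int \<nu>] (mod int d) \<longleftrightarrow> \<nu> = r"
      using r by (auto simp: cong_def)
    show "add_char d (int \<nu>) * (\<Sum>\<theta>\<in>dirichlet_chars d. cnj (\<theta> (int \<nu>)) * \<theta> n)
       = (if \<nu> = r then of_nat (totient d) * add_char d n else 0)"
    proof (cases "coprime (int \<nu>) (int d)")
      case True
      then show ?thesis
        using sum_dirichlet_chars_orthogonal[OF assms True, of n] eq add_char_cong[OF assms, of "int \<nu>" n]
        by (simp add: cong_sym_eq)
    next
      case False
      then have "\<nu> \<noteq> r" using \<open>coprime n (int d)\<close> assms r(1) by (metis coprime_mod_left_iff of_nat_0_less_iff less_irrefl)
      then show ?thesis using False by (auto simp: dirichlet_char_eq_0_iff intro!: sum.neutral)
    qed
  qed simp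
  finally show ?thesis using True r by simp
qed

section \<open>Gauss sums of primitive characters\<close>

text \<open>For \<open>n\<close> coprime to \<open>m\<close>, substitute \<open>n * \<nu>\<close>
  for the summation variable. Otherwise the right side is 0, and primitivity at the proper divisor m
  / gcd(n, m) supplies a unit \<open>b\<close> with \<open>b * n\<close> congruent to
  \<open>n\<close> and \<open>\<psi> b \<noteq> 1\<close>; the sum then equals
  \<open>\<psi> b\<close> times itself.\<close>

lemma sum_dirichlet_char_add_char:
  assumes "primitive_char m \<psi>"
  shows "(\<Sum>\<nu><m. \<psi> (int \<nu>) * add_char m (n * int \<nu>)) = cnj (\<psi> n) * gauss_sum m \<psi>"
proof -
  have char: "dirichlet_char m \<psi>" using assms by (simp add: primitive_char_def)
  note m = dirichlet_char_pos[OF char]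
  define G where "G = (\<Sum>\<nu><m. \<psi> (int \<nu>) * add_char m (n * int \<nu>))"
  have shift: "\<psi> b * (\<Sum>\<nu><m. \<psi> (int \<nu>) * add_char m (b * k * int \<nu>)) =
      (\<Sum>\<nu><m. \<psi> (int \<nu>) * add_char m (k * int \<nu>))" if b: "coprime b (int m)" for b k
  proof -
    have "(\<Sum>\<nu><m. \<psi> (b * int \<nu>) * add_char m (k * (b * int \<nu>)))
        = (\<Sum>\<nu><m. \<psi> (int \<nu>) * add_char m (k * int \<nu>))"
    proof (rule sum_residues_mult_unit[OF _ b])
      fix a
      show "\<psi> (a + int m) * add_char m (k * (a + int m)) = \<psi> a * add_char m (k * a)"
        using m add_char_cong[of m "k * (a + int m)" "k * a"]
        by (simp add: dirichlet_char_periodic[OF char] cong_def distrib_left)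
    qed
    then show ?thesis
      by (simp add: dirichlet_char_mult[OF char] sum_distrib_left mult_ac)
  qed
  show ?thesis
  proof (cases "coprime n (int m)")
    case True
    have "\<psi> n * G = gauss_sum m \<psi>"
      using shift[OF True, of 1] by (simp add: G_def gauss_sum_add_char)
    then have "cnj (\<psi> n) * \<psi> n * G = cnj (\<psi> n) * gauss_sum m \<psi>"
      by (simp add: mult.assoc)
    then show ?thesis
      using cnj_dirichlet_char_mult_self[OF char True] by (simp add: G_def)
  next
    case False
    define d where "d = nat (gcd n (int m))"
    have d: "int d = gcd n (int m)" by (simp add: d_def)
    have dm: "d dvd m" by (metis d gcd_dvd2 int_dvd_int_iff)
    have "d \<noteq> 1"
      using False d by (metis coprime_iff_gcd_eq_1 of_nat_1)
    moreover have "d > 0" using dm m by (auto intro!: Nat.gr0I)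
    ultimately have "d > 1" by simp
    have q: "m div d dvd m" "m div d < m"
      using dm \<open>d > 1\<close> m by (auto simp: dvd_div_eq_iff)
    then obtain b where b: "coprime b (int m)" "[b = 1] (mod int (m div d))" "\<psi> b \<noteq> 1"
      using assms unfolding primitive_char_def by blast
    have "int (m div d) dvd b - 1" using b(2) by (simp add: cong_iff_dvd_diff)
    moreover have "int d dvd n" by (simp add: d)
    ultimately have "int (m div d) * int d dvd (b - 1) * n" by (rule mult_dvd_mono)
    moreover have "int (m div d) * int d = int m"
      using dm by (metis dvd_div_mult_self of_nat_mult)
    ultimately have bn: "[b * n = n] (mod int m)"
      by (simp add: cong_iff_dvd_diff left_diff_distrib)
    have "add_char m (b * n * int \<nu>) = add_char m (n * int \<nu>)" for \<nu>
      by (intro add_char_cong m cong_mult bn cong_refl)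
    then have "\<psi> b * G = G"
      using shift[OF b(1), of n] by (simp add: G_def)
    then have "G = 0" using b(3) by simp
    moreover have "\<psi> n = 0" using False by (simp add: dirichlet_char_eq_0_iff[OF char])
    ultimately show ?thesis by (simp add: G_def)
  qed
qed

lemma primitive_char_cnj: "primitive_char m \<psi> \<Longrightarrow> primitive_char m (\<lambda>a. cnj (\<psi> a))"
  using dirichlet_char_cnj unfolding primitive_char_def by simp

text \<open>The exponential sum at -1 equals \<open>gauss_sum m \<psi>\<close>, evenness fixing the
  sign. Expanding \<open>\<psi> (int n)\<close> through the conjugate character and summing over
  \<open>n\<close> leaves just \<open>\<nu>\<close> congruent to 1.\<close>

lemma gauss_sum_mult_cnj:
  assumes "primitive_char m \<psi>" "even_char \<psi>"
  shows "gauss_sum m \<psi> * gauss_sum m (\<lambda>a. cnj (\<psi> a)) = of_nat m"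
proof -
  have char: "dirichlet_char m \<psi>" using assms by (simp add: primitive_char_def)
  note m = dirichlet_char_pos[OF char]
  have even: "\<psi> (- a) = \<psi> a" for a
    using dirichlet_char_mult[OF char, of "-1" a] assms(2) by (simp add: even_char_def)
  define \<tau> where "\<tau> = gauss_sum m (\<lambda>a. cnj (\<psi> a))"
  have "\<tau> * gauss_sum m \<psi> = \<tau> * (\<Sum>n<m. \<psi> (int n) * add_char m (- int n))"
    using sum_dirichlet_char_add_char[OF assms(1), of "-1"] even[of 1] dirichlet_char_1[OF char] by simp
  also have "\<dots> = (\<Sum>n<m. (\<Sum>\<nu><m. cnj (\<psi> (int \<nu>)) * add_char m (int n * int \<nu>)) * add_char m (- int n))"
    using sum_dirichlet_char_add_char[OF primitive_char_cnj[OF assms(1)]]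
    by (simp add: sum_distrib_left \<tau>_def mult_ac)
  also have "\<dots> = (\<Sum>\<nu><m. cnj (\<psi> (int \<nu>)) * (\<Sum>n<m. add_char m ((int \<nu> - 1) * int n)))"
  proof -
    have "add_char m ((int \<nu> - 1) * int n) = add_char m (int n * int \<nu>) * add_char m (- int n)" for \<nu> n
      unfolding add_char_add[symmetric] by (rule arg_cong[where f = "add_char m"]) (simp add: algebra_simps)
    then show ?thesis
      by (simp only: sum_distrib_left sum_distrib_right mult.assoc) (rule sum.swap)
  qed
  also have "\<dots> = (\<Sum>\<nu><m. if \<nu> = 1 mod m then of_nat m else 0)"
  proof (rule sum.cong)
    fix \<nu> assume "\<nu> \<in> {..<m}"
    then have "int m dvd int \<nu> - 1 \<longleftrightarrow> \<nu> = 1 mod m"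
      by (metis cong_def cong_iff_dvd_diff cong_int_iff lessThan_iff mod_less of_nat_1)
    moreover have "\<psi> (int \<nu>) = 1" if "int m dvd int \<nu> - 1"
      using that dirichlet_char_cong[OF char, of "int \<nu>" 1] dirichlet_char_1[OF char]
      by (simp add: cong_iff_dvd_diff)
    ultimately show "cnj (\<psi> (int \<nu>)) * (\<Sum>n<m. add_char m ((int \<nu> - 1) * int n)) = (if \<nu> = 1 mod m then of_nat m else 0)"
      using sum_add_char[OF m, of "int \<nu> - 1"] by simp
  qed simp
  also have "\<dots> = of_nat m" using m by simp
  finally show ?thesis by (simp add: \<tau>_def mult.commute)
qed

text \<open>The residues pair up under the map from a to m - a. The unpaired ones, 0 and possibly
  m/2, form \<open>M\<close> and contribute nothing by assumption.\<close>

lemma sum_lessThan_symmetric: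
  fixes f :: "int \<Rightarrow> 'a::comm_ring_1"
  assumes "\<And>a. f (int m - a) = f a" "f 0 = 0" "even m \<Longrightarrow> f (int (m div 2)) = 0"
  shows "(\<Sum>\<nu><m. f (int \<nu>)) = 2 * (\<Sum>a\<in>{a. 0 < a \<and> 2 * a < int m}. f a)"
proof -
  define H where "H = {a::int. 0 < a \<and> 2 * a < int m}"
  define M where "M = {a. 0 \<le> a \<and> a < int m \<and> (2 * a = int m \<or> a = 0)}"
  have fin: "finite H" by (rule finite_subset[of _ "{0..int m}"]) (auto simp: H_def)
  have finM: "finite M" by (rule finite_subset[of _ "{0..int m}"]) (auto simp: M_def)
  have "(\<Sum>\<nu><m. f (int \<nu>)) = (\<Sum>a\<in>{0..<int m}. f a)"
    by (rule sum.reindex_bij_witness[of _ nat int]) auto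
  also have "{0..<int m} = (H \<union> (\<lambda>a. int m - a) ` H) \<union> M"
  proof (intro equalityI subsetI)
    fix x assume "x \<in> {0..<int m}"
    moreover have "x \<in> (\<lambda>a. int m - a) ` H" if "int m - x \<in> H"
      using that by (intro image_eqI[of _ _ "int m - x"]) simp_all
    ultimately show "x \<in> (H \<union> (\<lambda>a. int m - a) ` H) \<union> M"
      unfolding H_def M_def by fastforce
  qed (auto simp: H_def M_def)
  also have "sum f \<dots> = sum f (H \<union> (\<lambda>a. int m - a) ` H) + sum f M"
    using fin finM by (intro sum.union_disjoint) (auto simp: H_def M_def)
  also have "sum f (H \<union> (\<lambda>a. int m - a) ` H) = sum f H + sum f ((\<lambda>a. int m - a) ` H)"
    using fin by (intro sum.union_disjoint) (auto simp: H_def)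
  also have "sum f ((\<lambda>a. int m - a) ` H) = sum f H"
    using assms(1) by (subst sum.reindex) (auto simp: inj_on_def)
  also have "sum f M = 0"
  proof (rule sum.neutral, rule ballI)
    fix x assume "x \<in> M"
    then have "x = 0 \<or> (even m \<and> x = int (m div 2))"
      unfolding M_def by (auto simp: zdiv_int) presburger+
    then show "f x = 0" using assms by auto
  qed
  finally show ?thesis by (simp add: H_def)
qed

text \<open>The transform \<open>G\<close> is even in \<open>n\<close>, so averaging over n and -n
  replaces exponentials by cosines, and pairing a with m - a halves the range. The factor
  \<open>of_nat m\<close> is the product of the two Gauss sums.\<close>

lemma primitive_even_char_eq_sum_cos:
  assumes "m > 1" "primitive_char m \<psi>" "even_char \<psi>"
  shows "of_nat m * \<psi> n = 2 * gauss_sum m \<psi> *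
    (\<Sum>a\<in>{a. 0 < a \<and> 2 * a < int m}. cnj (\<psi> a) * of_real (cos (2 * pi * a * n / m)))"
proof -
  have char: "dirichlet_char m \<psi>" using assms by (simp add: primitive_char_def)
  note m = dirichlet_char_pos[OF char]
  have even: "\<psi> (- a) = \<psi> a" for a
    using dirichlet_char_mult[OF char, of "-1" a] assms(3) by (simp add: even_char_def)
  have reflect: "\<psi> (int m - a) = \<psi> a" for a
    using dirichlet_char_periodic[OF char, of "- a"] even[of a] by (simp add: algebra_simps)
  define G where "G n = (\<Sum>\<nu><m. cnj (\<psi> (int \<nu>)) * add_char m (n * int \<nu>))" for n
  have G: "G n = \<psi> n * gauss_sum m (\<lambda>a. cnj (\<psi> a))" for n
    using sum_dirichlet_char_add_char[OF primitive_char_cnj[OF assms(2)]] by (simp add: G_def)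
  have "2 * G n = G n + G (- n)"
    by (simp add: G even)
  also have "\<dots> = (\<Sum>\<nu><m. cnj (\<psi> (int \<nu>)) * of_real (2 * cos (2 * pi * real_of_int (int \<nu>) * n / m)))"
    unfolding G_def sum.distrib[symmetric] distrib_left[symmetric]
    by (intro sum.cong arg_cong2[where f = "(*)"]) (simp_all add: add_char_def complex_eq_iff mult_ac)
  also have "\<dots> = 2 * (\<Sum>a\<in>{a. 0 < a \<and> 2 * a < int m}. cnj (\<psi> a) * of_real (2 * cos (2 * pi * a * n / m)))"
  proof (rule sum_lessThan_symmetric)
    fix a :: int
    have "cos (2 * pi * real_of_int (int m - a) * n / m) = cos (2 * pi * n - 2 * pi * a * n / m)"
      using m by (simp add: field_simps)
    also have "\<dots> = cos (2 * pi * a * n / m)"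
      using cos_diff[of "2 * pi * n" "2 * pi * a * n / m"] sin_int_2pin[of n] cos_int_2pin[of n] by simp
    finally show "cnj (\<psi> (int m - a)) * of_real (2 * cos (2 * pi * real_of_int (int m - a) * n / m))
        = cnj (\<psi> a) * of_real (2 * cos (2 * pi * a * n / m))"
      by (simp only: reflect)
  next
    \<comment> \<open>This uses \<open>m > 1\<close>: modulo 1 the integer 0 is a unit.\<close>
    have "\<psi> 0 = 0" using dirichlet_char_eq_0_iff[OF char, of 0] assms(1) by simp
    then show "cnj (\<psi> 0) * of_real (2 * cos (2 * pi * real_of_int 0 * n / m)) = 0" by simp
  next
    assume "even m"
    then obtain k where k: "m = 2 * k" by blast
    \<comment> \<open>The middle residue \<open>k\<close> divides \<open>m\<close>, so it could be a
      unit only for \<open>m = 2\<close>, and no primitive character modulo 2 exists.\<close>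
    have "k = 1" if "coprime k m"
      using that k by simp
    moreover have False if "k = 1"
    proof -
      have "m = 2" using k that by simp
      then obtain a where a: "coprime a 2" "\<psi> a \<noteq> 1"
        using assms(2) unfolding primitive_char_def by (metis assms(1) of_nat_numeral one_dvd)
      then have "[a = 1] (mod int m)" using \<open>m = 2\<close> by (simp add: cong_def) presburger
      then show False using a dirichlet_char_cong[OF char] dirichlet_char_1[OF char] by metis
    qed
    ultimately have "\<not> coprime k m" by blast
    then have "\<psi> (int k) = 0" by (simp add: dirichlet_char_eq_0_iff[OF char])
    then show "cnj (\<psi> (int (m div 2))) * of_real (2 * cos (2 * pi * real_of_int (int (m div 2)) * n / m)) = 0"
      by (simp add: k)
  qed
  also have "(\<Sum>a\<in>{a. 0 < a \<and> 2 * a < int m}. cnj (\<psi> a) * of_real (2 * cos (2 * pi * a * n / m)))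
      = 2 * (\<Sum>a\<in>{a. 0 < a \<and> 2 * a < int m}. cnj (\<psi> a) * of_real (cos (2 * pi * a * n / m)))"
    by (simp add: sum_distrib_left mult_ac)
  finally have "G n = 2 * (\<Sum>a\<in>{a. 0 < a \<and> 2 * a < int m}. cnj (\<psi> a) * of_real (cos (2 * pi * a * n / m)))"
    by (simp only: mult_cancel_left) simp
  moreover have "gauss_sum m \<psi> * G n = of_nat m * \<psi> n"
    unfolding G gauss_sum_mult_cnj[OF assms(2,3), symmetric] by (simp only: mult_ac)
  ultimately show ?thesis by (simp only: mult_ac)
qed

section \<open>The trigonometric series\<close>

text \<open>Times 2 sin(x/2), each term is a difference of cosines at half-integral multiples of x,
  and the sum telescopes. It gives the derivative of the cosine partial sums in closed form.\<close>

lemma sum_sin_multiples: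
  fixes x :: real
  shows "2 * sin (x / 2) * (\<Sum>k<n. sin (real (Suc k) * x)) = cos (x / 2) - cos ((real n + 1 / 2) * x)"
proof (induction n)
  case (Suc n)
  have *: "(real n + 1 / 2) * x = real (Suc n) * x - x / 2" "(real (Suc n) + 1 / 2) * x = real (Suc n) * x + x / 2"
    by (simp_all add: field_simps)
  have "2 * sin (x / 2) * sin (real (Suc n) * x) = cos ((real n + 1 / 2) * x) - cos ((real (Suc n) + 1 / 2) * x)"
    unfolding * cos_diff cos_add by simp
  then show ?case using Suc by (simp add: distrib_left)
qed simp

text \<open>
  The partial sum plus $\ln(2\sin(x/2))$ has derivative $\cos((n+\frac12)x)/(2\sin(x/2))$.  Subtracting
  $R_n(x) = \sin((n+\frac12)x)/((2n+1)\sin(x/2))$ leaves a derivative of size $O(1/n)$, so the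
  mean value theorem reduces everything to the alternating harmonic series at $x = \pi$.
\<close>

lemma uniform_limit_sum_cos:
  fixes \<delta> :: real
  assumes \<delta>: "0 < \<delta>" "\<delta> \<le> pi"
  shows "uniform_limit {\<delta>..pi} (\<lambda>n x. \<Sum>k<n. cos (real (Suc k) * x) / real (Suc k))
     (\<lambda>x. - ln (2 * sin (x / 2))) sequentially"
proof -
  define s0 where "s0 = sin (\<delta> / 2)"
  have s0: "s0 > 0" using \<delta> by (auto simp: s0_def intro!: sin_gt_zero)
  have s: "s0 \<le> sin (x / 2)" if "x \<in> {\<delta>..pi}" for x
    using that \<delta> unfolding s0_def by (intro sin_monotone_2pi_le) auto
  have spos: "sin (x / 2) > 0" if "x \<in> {\<delta>..pi}" for x
    using s[OF that] s0 by linarith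
  define E where "E n x = (\<Sum>k<n. cos (real (Suc k) * x) / real (Suc k)) + ln (2 * sin (x / 2))" for n x
  define R where "R n x = sin ((real n + 1 / 2) * x) / ((2 * real n + 1) * sin (x / 2))" for n x
  define G where "G n x = E n x - R n x" for n x
  \<comment> \<open>The summands bound \<open>G n\<close> at pi, its variation over an interval of
    length at most pi, and \<open>R n\<close>; each tends to 0.\<close>
  define B where "B n = \<bar>G n pi\<bar> + pi / (2 * (2 * real n + 1) * s0\<^sup>2) + 1 / ((2 * real n + 1) * s0)" for n
  have G': "(G n has_field_derivative sin ((real n + 1 / 2) * x) * cos (x / 2) / (2 * (2 * real n + 1) * (sin (x / 2))\<^sup>2))
     (at x within {\<delta>..pi})" if x: "x \<in> {\<delta>..pi}" for n x
  proof -
    let ?s = "sin (x / 2)" and ?c = "cos (x / 2)" and ?S = "sin ((real n + 1 / 2) * x)" and ?C = "cos ((real n + 1 / 2) * x)"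
    note sp = spos[OF x]
    have "(E n has_field_derivative (\<Sum>k<n. - sin (real (Suc k) * x)) + ?c / (2 * ?s)) (at x within {\<delta>..pi})"
      unfolding E_def using sp
      by (auto intro!: derivative_eq_intros sum.cong simp: field_simps simp del: of_nat_Suc)
    moreover have "(R n has_field_derivative ((real n + 1 / 2) * ?C * ((2 * real n + 1) * ?s)
         - ?S * ((2 * real n + 1) * (?c / 2))) / ((2 * real n + 1) * ?s)\<^sup>2) (at x within {\<delta>..pi})"
      unfolding R_def using sp
      by (auto intro!: derivative_eq_intros simp: power2_eq_square)
    ultimately have "(G n has_field_derivative ((\<Sum>k<n. - sin (real (Suc k) * x)) + ?c / (2 * ?s)) - 
        ((real n + 1 / 2) * ?C * ((2 * real n + 1) * ?s) - ?S * ((2 * real n + 1) * (?c / 2))) / ((2 * real n + 1) * ?s)\<^sup>2)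
        (at x within {\<delta>..pi})"
      unfolding G_def by (rule DERIV_diff)
    moreover have "(\<Sum>k<n. - sin (real (Suc k) * x)) = - ((?c - ?C) / (2 * ?s))"
      using sum_sin_multiples[of x n] sp by (simp add: sum_negf field_simps del: of_nat_Suc)
    moreover have "((real n + 1 / 2) * ?C * ((2 * real n + 1) * ?s) - ?S * ((2 * real n + 1) * (?c / 2))) / ((2 * real n + 1) * ?s)\<^sup>2
       = ?C / (2 * ?s) - ?S * ?c / (2 * (2 * real n + 1) * ?s\<^sup>2)"
    proof -
      define N where "N = 2 * real n + 1"
      have "N > 0" "real n + 1 / 2 = N / 2" by (simp_all add: N_def)
      then show ?thesis unfolding N_def[symmetric] using sp
        by (simp only:) (simp add: divide_simps power2_eq_square, simp add: algebra_simps)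
    qed
    ultimately have "(G n has_field_derivative - ((?c - ?C) / (2 * ?s)) + ?c / (2 * ?s)
        - (?C / (2 * ?s) - ?S * ?c / (2 * (2 * real n + 1) * ?s\<^sup>2))) (at x within {\<delta>..pi})"
      by (simp only:)
    moreover have "- ((?c - ?C) / (2 * ?s)) + ?c / (2 * ?s) - (?C / (2 * ?s) - ?S * ?c / (2 * (2 * real n + 1) * ?s\<^sup>2))
        = ?S * ?c / (2 * (2 * real n + 1) * ?s\<^sup>2)"
      by (simp add: diff_divide_distrib)
    ultimately show ?thesis by (simp only:)
  qed
  have E: "\<bar>E n x\<bar> \<le> B n" if x: "x \<in> {\<delta>..pi}" for n x
  proof -
    have "norm (G n x - G n pi) \<le> 1 / (2 * (2 * real n + 1) * s0\<^sup>2) * norm (x - pi)"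
    proof (rule field_differentiable_bound[OF _ G'])
      fix y assume y: "y \<in> {\<delta>..pi}"
      have "\<bar>sin ((real n + 1 / 2) * y) * cos (y / 2)\<bar> \<le> 1 * 1"
        unfolding abs_mult by (intro mult_mono) auto
      moreover have "s0\<^sup>2 \<le> (sin (y / 2))\<^sup>2" using s[OF y] s0 by (intro power_mono) auto
      ultimately show "norm (sin ((real n + 1 / 2) * y) * cos (y / 2) / (2 * (2 * real n + 1) * (sin (y / 2))\<^sup>2))
          \<le> 1 / (2 * (2 * real n + 1) * s0\<^sup>2)"
        using s0 by (auto simp: abs_mult intro!: frac_le mult_left_mono)
    qed (use x \<delta> in auto)
    also have "\<dots> \<le> 1 / (2 * (2 * real n + 1) * s0\<^sup>2) * pi"
      using x \<delta> s0 by (intro mult_left_mono) auto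
    finally have "\<bar>G n x\<bar> \<le> \<bar>G n pi\<bar> + pi / (2 * (2 * real n + 1) * s0\<^sup>2)" by simp
    moreover have "\<bar>R n x\<bar> \<le> 1 / ((2 * real n + 1) * s0)"
      unfolding R_def using s[OF x] s0 by (auto simp: abs_mult intro!: frac_le mult_left_mono)
    moreover have "E n x = G n x + R n x" by (simp add: G_def)
    ultimately show ?thesis unfolding B_def by linarith
  qed
  have "(\<lambda>n. G n pi) \<longlonglongrightarrow> 0"
  proof -
    have "(\<lambda>k. - ((-1) ^ k / real (Suc k))) sums - ln 2"
      by (intro sums_minus alternating_harmonic_series_sums)
    then have "(\<lambda>n. (\<Sum>k<n. cos (real (Suc k) * pi) / real (Suc k)) + ln (2 * sin (pi / 2))) \<longlonglongrightarrow> - ln 2 + ln (2 * sin (pi / 2))"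
      unfolding sums_def by (intro tendsto_add tendsto_const) (simp add: cos_npi del: of_nat_Suc)
    then have "(\<lambda>n. E n pi) \<longlonglongrightarrow> 0" by (simp add: E_def)
    moreover have "(\<lambda>n. R n pi) \<longlonglongrightarrow> 0"
    proof (rule Lim_null_comparison)
      show "\<forall>\<^sub>F n in sequentially. norm (R n pi) \<le> 1 / (2 * real n + 1)"
        by (intro always_eventually allI) (simp add: R_def divide_right_mono)
      show "(\<lambda>n. 1 / (2 * real n + 1)) \<longlonglongrightarrow> 0" by real_asymp
    qed
    ultimately show ?thesis unfolding G_def by (auto intro: tendsto_eq_intros)
  qed
  then have "B \<longlonglongrightarrow> \<bar>0\<bar> + 0 + 0"
    unfolding B_def
  proof (intro tendsto_add tendsto_rabs)
    show "(\<lambda>n. pi / (2 * (2 * real n + 1) * s0\<^sup>2)) \<longlonglongrightarrow> 0" "(\<lambda>n. 1 / ((2 * real n + 1) * s0)) \<longlonglongrightarrow> 0"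
      using s0 by real_asymp+
  qed
  then have B0: "B \<longlonglongrightarrow> 0" by simp
  show ?thesis
  proof (rule uniform_limitI)
    fix e :: real assume "e > 0"
    then have "\<forall>\<^sub>F n in sequentially. B n < e" using B0 by (simp add: order_tendstoD(2))
    then show "\<forall>\<^sub>F n in sequentially. \<forall>x\<in>{\<delta>..pi}.
        dist (\<Sum>k<n. cos (real (Suc k) * x) / real (Suc k)) (- ln (2 * sin (x / 2))) < e"
    proof eventually_elim
      case (elim n)
      then show ?case using E[of _ n] unfolding dist_real_def E_def by force
    qed
  qed
qed

lemma sums_cos_over_n:
  fixes x :: real
  assumes "0 < x" "x \<le> pi"
  shows "(\<lambda>k. cos (real (Suc k) * x) / real (Suc k)) sums - ln (2 * sin (x / 2))"
  using tendsto_uniform_limitI[OF uniform_limit_sum_cos[OF assms], of x] assms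
  by (simp add: sums_def)

section \<open>Clausen functions of orders 2 and 3\<close>

definition Cl2 :: "real \<Rightarrow> real" where
  "Cl2 x = (\<Sum>k. sin (real (Suc k) * x) / real (Suc k) ^ 2)"

definition Cl3 :: "real \<Rightarrow> real" where
  "Cl3 x = (\<Sum>k. cos (real (Suc k) * x) / real (Suc k) ^ 3)"

lemma summable_inverse_Suc_power: "s \<ge> 2 \<Longrightarrow> summable (\<lambda>k. 1 / real (Suc k) ^ s)"
  using inverse_power_summable[of s, where 'a = real] summable_Suc_iff[of "\<lambda>k. inverse (real k ^ s)"]
  by (simp add: divide_inverse)

lemma summable_bounded_over_power:
  fixes f :: "nat \<Rightarrow> 'a :: {real_normed_field, banach}"
  assumes "s \<ge> 2" "\<And>k. norm (f k) \<le> 1"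
  shows "summable (\<lambda>k. f k / of_nat (Suc k) ^ s)"
proof (rule summable_comparison_test'[OF summable_inverse_Suc_power[OF assms(1)]])
  fix n
  show "norm (f n / of_nat (Suc n) ^ s) \<le> 1 / real (Suc n) ^ s"
    using assms(2)[of n] by (simp add: norm_divide norm_power divide_right_mono del: of_nat_Suc)
qed

text \<open>The differentiated series converges uniformly only away from 0, hence the interval from
  x/2 to pi, which has \<open>x\<close> in its interior.\<close>

lemma has_field_derivative_Cl2:
  assumes "0 < x" "x < pi"
  shows "(Cl2 has_field_derivative - ln (2 * sin (x / 2))) (at x)"
proof -
  have "(Cl2 has_field_derivative (\<Sum>k. cos (real (Suc k) * x) / real (Suc k))) (at x)"
    unfolding Cl2_def
  proof (rule has_field_derivative_series'(2)[of "{x / 2..pi}"])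
    fix k y
    show "((\<lambda>x. sin (real (Suc k) * x) / real (Suc k) ^ 2) has_field_derivative cos (real (Suc k) * y) / real (Suc k))
       (at y within {x / 2..pi})"
      by (auto intro!: derivative_eq_intros simp: field_simps power2_eq_square simp del: of_nat_Suc)
  next
    show "uniformly_convergent_on {x / 2..pi} (\<lambda>n x. \<Sum>i<n. cos (real (Suc i) * x) / real (Suc i))"
      using uniform_limit_sum_cos[of "x / 2"] assms unfolding uniformly_convergent_on_def by auto
    show "summable (\<lambda>k. sin (real (Suc k) * x) / real (Suc k) ^ 2)"
      by (rule summable_bounded_over_power) auto
  qed (use assms in \<open>auto simp: interior_atLeastAtMost_real\<close>)
  then show ?thesis using sums_cos_over_n[of x] assms by (simp add: sums_iff)
qed

lemma uniform_limit_Cl2: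
  "uniform_limit UNIV (\<lambda>n x. \<Sum>k<n. sin (real (Suc k) * x) / real (Suc k) ^ 2) Cl2 sequentially"
  unfolding Cl2_def
  by (rule Weierstrass_m_test[OF _ summable_inverse_Suc_power[of 2]]) (simp_all add: divide_right_mono del: of_nat_Suc)

text \<open>Continuity at 0, which the derivative formula does not reach, is needed for the limit
  that fixes the constant in \<open>cb_series_3\<close>.\<close>

lemma continuous_Cl2: "continuous_on UNIV Cl2"
  by (rule uniform_limit_theorem[OF _ uniform_limit_Cl2]) (auto intro!: always_eventually continuous_intros)

lemma has_field_derivative_Cl3: "(Cl3 has_field_derivative - Cl2 x) (at x)"
proof -
  have "(Cl3 has_field_derivative (\<Sum>k. - (sin (real (Suc k) * x) / real (Suc k) ^ 2))) (at x)"
    unfolding Cl3_def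
  proof (rule has_field_derivative_series'(2)[of UNIV])
    fix k and y :: real
    show "((\<lambda>x. cos (real (Suc k) * x) / real (Suc k) ^ 3) has_field_derivative - (sin (real (Suc k) * y) / real (Suc k) ^ 2))
       (at y within UNIV)"
      by (auto intro!: derivative_eq_intros simp: field_simps power2_eq_square power3_eq_cube simp del: of_nat_Suc)
  next
    have "uniformly_convergent_on UNIV (\<lambda>n x. - (\<Sum>k<n. sin (real (Suc k) * x) / real (Suc k) ^ 2))"
      unfolding uniformly_convergent_on_def by (intro exI) (rule uniform_limit_uminus[OF uniform_limit_Cl2])
    then show "uniformly_convergent_on UNIV (\<lambda>n x. \<Sum>k<n. - (sin (real (Suc k) * x) / real (Suc k) ^ 2))"
      by (simp add: sum_negf)
    show "summable (\<lambda>k. cos (real (Suc k) * x) / real (Suc k) ^ 3)"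
      by (rule summable_bounded_over_power) auto
  qed auto
  moreover have "summable (\<lambda>k. sin (real (Suc k) * x) / real (Suc k) ^ 2)"
    by (rule summable_bounded_over_power) auto
  ultimately show ?thesis by (simp add: suminf_minus Cl2_def)
qed

section \<open>The central binomial series\<close>

text \<open>Two absorption identities are joined by the symmetry of
  \<open>Suc (2 * n) choose n\<close>; a common factor \<open>Suc n\<close> is then
  cancelled.\<close>

lemma central_binomial_Suc: "Suc n * ((2 * Suc n) choose Suc n) = 2 * (2 * n + 1) * ((2 * n) choose n)"
proof -
  have "Suc n * (Suc (2 * n) choose Suc n) = Suc (2 * n) * (2 * n choose n)"
    by (rule Suc_times_binomial)
  moreover have "Suc (2 * n) choose Suc n = Suc (2 * n) choose n"
    using binomial_symmetric[of n "Suc (2 * n)"] by simp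
  moreover have "Suc n * (Suc (Suc (2 * n)) choose Suc n) = Suc (Suc (2 * n)) * (Suc (2 * n) choose n)"
    by (rule Suc_times_binomial)
  moreover have "2 * Suc n = Suc (Suc (2 * n))" by simp
  ultimately have "Suc n * (Suc n * ((2 * Suc n) choose Suc n)) = Suc n * (2 * (2 * n + 1) * ((2 * n) choose n))"
    by (metis (no_types, lifting) Suc_eq_plus1 mult.assoc mult.left_commute)
  then show ?thesis by (simp only: mult_cancel1) simp
qed

text \<open>
  Indices are shifted by one: these are the coefficients of $u^n$ in
  $\sum_{n\ge1} 4^n u^{n-1}/(n\binom{2n}{n})$.
\<close>

definition cb_coeff :: "nat \<Rightarrow> real" where
  "cb_coeff n = 4 ^ Suc n / (real (Suc n) * real ((2 * Suc n) choose Suc n))"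

lemma cb_coeff_pos: "cb_coeff n > 0"
  by (simp add: cb_coeff_def zero_less_binomial del: mult_Suc_right)

lemma cb_coeff_0: "cb_coeff 0 = 2"
  by (simp add: cb_coeff_def numeral_2_eq_2)

text \<open>The ratio (2n+2)/(2n+3) of consecutive coefficients is below 1, which bounds them all by
  the first, and it encodes a first-order differential equation for the generating function.\<close>

lemma cb_coeff_Suc: "(2 * real n + 3) * cb_coeff (Suc n) = (2 * real n + 2) * cb_coeff n"
proof -
  define C where "C = real ((2 * Suc n) choose Suc n)"
  have C: "C > 0" by (simp add: C_def zero_less_binomial del: mult_Suc_right)
  have "real (Suc (Suc n) * ((2 * Suc (Suc n)) choose Suc (Suc n))) = real (2 * (2 * Suc n + 1) * ((2 * Suc n) choose Suc n))"
    by (simp only: central_binomial_Suc)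
  then have "real (Suc (Suc n)) * real ((2 * Suc (Suc n)) choose Suc (Suc n)) = 2 * (2 * real n + 3) * C"
    unfolding C_def of_nat_mult by (simp del: mult_Suc_right binomial_Suc_Suc)
  then have "cb_coeff (Suc n) = 4 ^ Suc (Suc n) / (2 * (2 * real n + 3) * C)"
    unfolding cb_coeff_def by (simp only:)
  moreover have "cb_coeff n = 4 ^ Suc n / ((real n + 1) * C)"
    by (simp add: cb_coeff_def C_def del: mult_Suc_right binomial_Suc_Suc)
  moreover define p N M where "p = (4::real) ^ Suc n" and "N = 2 * real n + 3" and "M = real n + 1"
  ultimately have "cb_coeff (Suc n) = 4 * p / (2 * N * C)" "cb_coeff n = p / (M * C)"
    by (simp_all only: power_Suc)
  moreover have "N > 0" "M > 0" by (simp_all add: N_def M_def)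
  ultimately have "N * cb_coeff (Suc n) = 2 * M * cb_coeff n"
    using C by simp
  then show ?thesis by (simp add: N_def M_def)
qed

lemma cb_coeff_le: "cb_coeff n \<le> 2"
proof (induction n)
  case (Suc n)
  have "(2 * real n + 3) * cb_coeff (Suc n) \<le> (2 * real n + 3) * cb_coeff n"
    unfolding cb_coeff_Suc using cb_coeff_pos[of n] by (intro mult_right_mono) auto
  then show ?case using Suc by simp
qed (simp add: cb_coeff_0)

lemma summable_cb_coeff:
  fixes u :: real
  assumes "\<bar>u\<bar> < 1" "\<And>n. \<bar>c n\<bar> \<le> 2"
  shows "summable (\<lambda>n. c n * u ^ n)"
proof (rule summable_comparison_test')
  show "summable (\<lambda>n. 2 * \<bar>u\<bar> ^ n)" using assms by (intro summable_mult summable_geometric) auto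
  show "norm (c n * u ^ n) \<le> 2 * \<bar>u\<bar> ^ n" for n
    using assms(2)[of n] by (simp add: abs_mult power_abs mult_right_mono)
qed

lemma has_field_derivative_bounded_powser:
  fixes u :: real
  assumes "\<bar>u\<bar> < 1" "\<And>n. \<bar>c n\<bar> \<le> 2"
  shows "((\<lambda>u. \<Sum>n. c n * u ^ n) has_field_derivative (\<Sum>n. diffs c n * u ^ n)) (at u)"
  using termdiffs_strong'[of 1 c u] summable_cb_coeff[of _ c] assms by auto

text \<open>This is \<open>cb_coeff_Suc\<close> multiplied by u^(n+1) and summed over n. The right
  side is \<open>cb_coeff 0\<close>, the term lost in the index shift.\<close>

lemma cb_series_ode:
  fixes u :: real
  assumes "\<bar>u\<bar> < 1"
  shows "(1 - 2 * u) * (\<Sum>n. cb_coeff n * u ^ n) + 2 * u * (1 - u) * (\<Sum>n. diffs cb_coeff n * u ^ n) = 2"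
proof -
  define B where "B = (\<Sum>n. cb_coeff n * u ^ n)"
  define Q where "Q = (\<Sum>n. diffs cb_coeff n * u ^ n)"
  have b: "\<bar>cb_coeff n\<bar> \<le> 2" for n using cb_coeff_le[of n] cb_coeff_pos[of n] by simp
  have B: "(\<lambda>n. cb_coeff n * u ^ n) sums B"
    unfolding B_def by (intro summable_sums summable_cb_coeff assms b)
  have Q: "(\<lambda>n. diffs cb_coeff n * u ^ n) sums Q"
    unfolding Q_def using summable_cb_coeff[of _ cb_coeff] b assms
    by (intro summable_sums termdiff_converges[of u 1]) auto
  have "(\<lambda>n. cb_coeff (Suc n) * u ^ Suc n) sums (B - cb_coeff 0)"
    using B sums_Suc_iff[of "\<lambda>n. cb_coeff n * u ^ n"] by simp
  moreover have "(\<lambda>n. u * (2 * (diffs cb_coeff n * u ^ n))) sums (u * (2 * Q))"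
    by (intro sums_mult Q)
  moreover have "(\<lambda>n. real n * cb_coeff n * u ^ n) sums (u * Q)"
    using sums_mult[OF Q, of u] sums_Suc_iff[of "\<lambda>n. real n * cb_coeff n * u ^ n"]
    by (simp add: diffs_def mult_ac)
  then have "(\<lambda>n. 2 * u * (real n * cb_coeff n * u ^ n)) sums (2 * u * (u * Q))"
    by (rule sums_mult)
  moreover have "(\<lambda>n. 2 * u * (cb_coeff n * u ^ n)) sums (2 * u * B)"
    by (intro sums_mult B)
  ultimately have "(\<lambda>n. (cb_coeff (Suc n) * u ^ Suc n + u * (2 * (diffs cb_coeff n * u ^ n)))
      - (2 * u * (real n * cb_coeff n * u ^ n) + 2 * u * (cb_coeff n * u ^ n)))
      sums ((B - cb_coeff 0 + u * (2 * Q)) - (2 * u * (u * Q) + 2 * u * B))"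
    by (intro sums_diff sums_add)
  moreover have "(cb_coeff (Suc n) * u ^ Suc n + u * (2 * (diffs cb_coeff n * u ^ n)))
      - (2 * u * (real n * cb_coeff n * u ^ n) + 2 * u * (cb_coeff n * u ^ n)) = 0" for n
  proof -
    have "(cb_coeff (Suc n) * u ^ Suc n + u * (2 * (diffs cb_coeff n * u ^ n)))
      - (2 * u * (real n * cb_coeff n * u ^ n) + 2 * u * (cb_coeff n * u ^ n))
      = u ^ Suc n * ((2 * real n + 3) * cb_coeff (Suc n) - (2 * real n + 2) * cb_coeff n)"
      by (simp add: diffs_def algebra_simps)
    then show ?thesis by (simp only: cb_coeff_Suc) simp
  qed
  ultimately have "(B - cb_coeff 0 + u * (2 * Q)) - (2 * u * (u * Q) + 2 * u * B) = 0"
    by (simp add: sums_iff)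
  then show ?thesis unfolding B_def[symmetric] Q_def[symmetric] cb_coeff_0 by (simp add: algebra_simps)
qed

text \<open>The index shift is undone: the coefficient of u^n is 4^n / (n^2 binom(2n,n)) for n > 0,
  and \<open>cb_coeff3\<close> has n^3 instead. Both are 0 at n = 0, the latter because 0 / 0 =
  0.\<close>

definition cb_coeff2 :: "nat \<Rightarrow> real" where
  "cb_coeff2 n = (if n = 0 then 0 else cb_coeff (n - 1) / real n)"

definition cb_coeff3 :: "nat \<Rightarrow> real" where
  "cb_coeff3 n = cb_coeff2 n / real n"

lemma cb_coeff2_bound: "\<bar>cb_coeff2 n\<bar> \<le> 2"
proof (cases n)
  case (Suc k)
  have "\<bar>cb_coeff2 n\<bar> \<le> cb_coeff k / 1"
    unfolding cb_coeff2_def Suc using cb_coeff_pos[of k]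
    by (auto simp: abs_mult simp del: div_by_1 of_nat_Suc intro!: frac_le)
  then show ?thesis using cb_coeff_le[of k] by simp
qed (simp add: cb_coeff2_def)

lemma cb_coeff3_bound: "\<bar>cb_coeff3 n\<bar> \<le> 2"
proof (cases n)
  case (Suc k)
  have "\<bar>cb_coeff3 n\<bar> \<le> \<bar>cb_coeff2 n\<bar> / 1"
    unfolding cb_coeff3_def abs_divide by (rule frac_le) (auto simp: Suc)
  then show ?thesis using cb_coeff2_bound[of n] by simp
qed (simp add: cb_coeff3_def)

lemma diffs_cb_coeff2: "diffs cb_coeff2 n = cb_coeff n"
  by (simp add: diffs_def cb_coeff2_def)

lemma diffs_cb_coeff3: "diffs cb_coeff3 n = cb_coeff2 (Suc n)"
  by (simp add: diffs_def cb_coeff3_def del: of_nat_Suc)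

lemma sin_squared_less_1:
  assumes "0 \<le> t" "t < pi / 2"
  shows "\<bar>(sin t)\<^sup>2\<bar> < 1"
proof -
  have "cos t > 0" using assms by (intro cos_gt_zero_pi) auto
  then have "(cos t)\<^sup>2 > 0" by simp
  then have "(sin t)\<^sup>2 < 1" using sin_cos_squared_add[of t] by linarith
  then show ?thesis by simp
qed

lemma eq_of_derivative_eq:
  fixes f g :: "real \<Rightarrow> real"
  assumes "convex S" "\<And>x. x \<in> S \<Longrightarrow> (f has_field_derivative D x) (at x)"
    "\<And>x. x \<in> S \<Longrightarrow> (g has_field_derivative D x) (at x)" "a \<in> S" "f a = g a" "t \<in> S"
  shows "f t = g t"
proof -
  have "\<exists>c. \<forall>x\<in>S. f x - g x = c"
  proof (rule has_field_derivative_zero_constant[OF assms(1)])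
    fix x assume "x \<in> S"
    then have "((\<lambda>x. f x - g x) has_field_derivative D x - D x) (at x)"
      by (intro DERIV_diff assms(2,3))
    then show "((\<lambda>x. f x - g x) has_field_derivative 0) (at x within S)"
      by (simp add: has_field_derivative_at_within)
  qed
  then show ?thesis using assms(4-6) by (metis eq_iff_diff_eq_0)
qed

text \<open>Up to the factor cos t this is the classical series of 2 arcsin y / sqrt(1 - y^2) at y =
  sin t. With cos^2 = 1 - sin^2, the derivative in t becomes the left side of
  \<open>cb_series_ode\<close> at u = (sin t)^2, hence 2.\<close>

lemma cb_series_1:
  assumes "0 \<le> t" "t < pi / 2"
  shows "sin t * cos t * (\<Sum>n. cb_coeff n * ((sin t)\<^sup>2) ^ n) = 2 * t"
proof (rule eq_of_derivative_eq[of "{0..<pi / 2}" _ "\<lambda>_. 2" _ 0 t])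
  fix x assume x: "x \<in> {0..<pi / 2}"
  let ?u = "(sin x)\<^sup>2" and ?s = "sin x" and ?c = "cos x"
  let ?B = "\<Sum>n. cb_coeff n * ?u ^ n" and ?Q = "\<Sum>n. diffs cb_coeff n * ?u ^ n"
  have u: "\<bar>?u\<bar> < 1" using x by (intro sin_squared_less_1) auto
  have "\<bar>cb_coeff n\<bar> \<le> 2" for n using cb_coeff_le[of n] cb_coeff_pos[of n] by simp
  from has_field_derivative_bounded_powser[OF u this]
  have "((\<lambda>t. \<Sum>n. cb_coeff n * ((sin t)\<^sup>2) ^ n) has_field_derivative ?Q * (2 * ?s * ?c)) (at x)"
    by (rule DERIV_chain2) (auto intro!: derivative_eq_intros)
  then have "((\<lambda>t. sin t * cos t * (\<Sum>n. cb_coeff n * ((sin t)\<^sup>2) ^ n)) has_field_derivative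
      (?c * ?c - ?s * ?s) * ?B + ?s * ?c * (?Q * (2 * ?s * ?c))) (at x)"
    by (auto intro!: derivative_eq_intros simp: algebra_simps)
  moreover have "(?c * ?c - ?s * ?s) * ?B + ?s * ?c * (?Q * (2 * ?s * ?c)) = 2"
  proof -
    have c: "?c\<^sup>2 = 1 - ?u" by (rule cos_squared_eq)
    have "(?c * ?c - ?s * ?s) * ?B + ?s * ?c * (?Q * (2 * ?s * ?c)) = (?c\<^sup>2 - ?u) * ?B + 2 * ?u * ?c\<^sup>2 * ?Q"
      by (simp add: power2_eq_square algebra_simps)
    also have "\<dots> = 2" unfolding c using cb_series_ode[OF u] by (simp add: algebra_simps)
    finally show ?thesis .
  qed
  ultimately show "((\<lambda>t. sin t * cos t * (\<Sum>n. cb_coeff n * ((sin t)\<^sup>2) ^ n)) has_field_derivative 2) (at x)"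
    by simp
qed (use assms in \<open>auto intro!: derivative_eq_intros\<close>)

text \<open>The series of 2 (arcsin y)^2 at y = sin t: by the chain rule its derivative is twice the
  expression in \<open>cb_series_1\<close>, that is, 4 t.\<close>

lemma cb_series_2:
  assumes "0 \<le> t" "t < pi / 2"
  shows "(\<Sum>n. cb_coeff2 n * ((sin t)\<^sup>2) ^ n) = 2 * t\<^sup>2"
proof (rule eq_of_derivative_eq[of "{0..<pi / 2}" _ "\<lambda>x. 4 * x" _ 0 t])
  fix x assume x: "x \<in> {0..<pi / 2}"
  let ?u = "(sin x)\<^sup>2"
  have u: "\<bar>?u\<bar> < 1" using x by (intro sin_squared_less_1) auto
  from has_field_derivative_bounded_powser[of _ cb_coeff2, OF u cb_coeff2_bound]
  have "((\<lambda>t. \<Sum>n. cb_coeff2 n * ((sin t)\<^sup>2) ^ n) has_field_derivative (\<Sum>n. cb_coeff n * ?u ^ n) * (2 * sin x * cos x)) (at x)"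
    unfolding diffs_cb_coeff2 by (rule DERIV_chain2) (auto intro!: derivative_eq_intros)
  moreover have "(\<Sum>n. cb_coeff n * ?u ^ n) * (2 * sin x * cos x) = 4 * x"
    using cb_series_1[of x] x by (simp add: mult_ac)
  ultimately show "((\<lambda>t. \<Sum>n. cb_coeff2 n * ((sin t)\<^sup>2) ^ n) has_field_derivative 4 * x) (at x)" by simp
next
  have "(\<lambda>n. cb_coeff2 n * ((sin 0)\<^sup>2) ^ n) = (\<lambda>n. 0)"
    by (auto simp: cb_coeff2_def fun_eq_iff power_0_left)
  then show "(\<Sum>n. cb_coeff2 n * ((sin 0)\<^sup>2) ^ n) = 2 * 0\<^sup>2" by simp
qed (use assms in \<open>auto intro!: derivative_eq_intros\<close>)

lemma has_field_derivative_cb_series_3: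
  assumes "0 < t" "t < pi / 2"
  shows "((\<lambda>t. \<Sum>n. cb_coeff3 n * ((sin t)\<^sup>2) ^ n) has_field_derivative 4 * t\<^sup>2 * cos t / sin t) (at t)"
proof -
  let ?u = "(sin t)\<^sup>2"
  have s: "sin t > 0" using assms by (intro sin_gt_zero) auto
  have u: "\<bar>?u\<bar> < 1" using assms by (intro sin_squared_less_1) auto
  have "(\<lambda>n. cb_coeff2 n * ?u ^ n) sums (2 * t\<^sup>2)"
    using summable_cb_coeff[OF u cb_coeff2_bound] cb_series_2[of t] assms by (simp add: sums_iff)
  \<comment> \<open>The term at 0 vanishes, so the shift keeps the sum. Dividing by
    \<open>?u\<close>, which is positive for t > 0, then gives the derivative in u of the series
    with \<open>cb_coeff3\<close>.\<close>
  then have "(\<lambda>n. cb_coeff2 (Suc n) * ?u ^ Suc n) sums (2 * t\<^sup>2)"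
    using sums_Suc_iff[of "\<lambda>n. cb_coeff2 n * ?u ^ n" "2 * t\<^sup>2"] by (simp add: cb_coeff2_def)
  from sums_mult[OF this, of "1 / ?u"] have "(\<lambda>n. cb_coeff2 (Suc n) * ?u ^ n) sums (2 * t\<^sup>2 / ?u)"
    using s by (simp add: field_simps)
  then have eq: "(\<Sum>n. cb_coeff2 (Suc n) * ?u ^ n) = 2 * t\<^sup>2 / ?u" by (simp add: sums_iff)
  from has_field_derivative_bounded_powser[of _ cb_coeff3, OF u cb_coeff3_bound]
  have "((\<lambda>t. \<Sum>n. cb_coeff3 n * ((sin t)\<^sup>2) ^ n) has_field_derivative (2 * t\<^sup>2 / ?u) * (2 * sin t * cos t)) (at t)"
    unfolding diffs_cb_coeff3 eq by (rule DERIV_chain2) (auto intro!: derivative_eq_intros)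
  moreover have "(2 * t\<^sup>2 / ?u) * (2 * sin t * cos t) = 4 * t\<^sup>2 * cos t / sin t"
    using s by (simp add: field_simps power2_eq_square)
  ultimately show ?thesis by simp
qed

text \<open>In the derivative of \<open>D\<close> the terms 8 t ln(2 sin t) and 4 Cl2(2 t) cancel,
  and 4 t^2 cot t cancels against the derivative of \<open>F\<close>. The constant is the right
  limit at 0, where t^2 ln t tends to 0 and 2 Cl3(0) remains.\<close>

lemma cb_series_3:
  assumes t: "0 < t" "t < pi / 2"
  shows "(\<Sum>n. cb_coeff3 n * ((sin t)\<^sup>2) ^ n)
     = 4 * t\<^sup>2 * ln (2 * sin t) + 4 * t * Cl2 (2 * t) + 2 * Cl3 (2 * t) - 2 * Cl3 0"
proof -
  define F where "F t = (\<Sum>n. cb_coeff3 n * ((sin t)\<^sup>2) ^ n)" for t :: real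
  define D where "D t = 4 * t\<^sup>2 * ln (2 * sin t) + 4 * t * Cl2 (2 * t) + 2 * Cl3 (2 * t) - F t" for t
  have "\<exists>c. \<forall>x\<in>{0<..<pi / 2}. D x = c"
  proof (rule has_field_derivative_zero_constant)
    fix x assume x: "x \<in> {0<..<pi / 2}"
    have s: "sin x > 0" using x by (intro sin_gt_zero) auto
    have "((\<lambda>t. Cl2 (2 * t)) has_field_derivative - ln (2 * sin (2 * x / 2)) * 2) (at x)"
      using x by (intro DERIV_chain2[OF has_field_derivative_Cl2]) (auto intro!: derivative_eq_intros)
    moreover have "((\<lambda>t. Cl3 (2 * t)) has_field_derivative - Cl2 (2 * x) * 2) (at x)"
      by (intro DERIV_chain2[OF has_field_derivative_Cl3]) (auto intro!: derivative_eq_intros)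
    moreover have "(F has_field_derivative 4 * x\<^sup>2 * cos x / sin x) (at x)"
      unfolding F_def using x by (intro has_field_derivative_cb_series_3) auto
    ultimately have "(D has_field_derivative 0) (at x)"
      unfolding D_def using s
      by (auto intro!: derivative_eq_intros simp: field_simps power2_eq_square)
    then show "(D has_field_derivative 0) (at x within {0<..<pi / 2})"
      by (rule has_field_derivative_at_within)
  qed auto
  then obtain c where c: "\<And>x. x \<in> {0<..<pi / 2} \<Longrightarrow> D x = c" by blast
  have "(D \<longlongrightarrow> 0 + 4 * 0 * Cl2 (2 * 0) + 2 * Cl3 (2 * 0) - F 0) (at_right 0)"
    unfolding D_def
  proof (intro tendsto_add tendsto_diff tendsto_mult tendsto_const)
    show "((\<lambda>t::real. 4 * t\<^sup>2 * ln (2 * sin t)) \<longlongrightarrow> 0) (at_right 0)" by real_asymp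
    have right: "(f \<longlongrightarrow> f 0) (at_right 0)" if "isCont f 0" for f :: "real \<Rightarrow> real"
      using that unfolding isCont_def by (rule tendsto_within_subset) simp
    have "isCont Cl2 x" for x
      using continuous_on_eq_continuous_at[OF open_UNIV, of Cl2] continuous_Cl2 by blast
    then show "((\<lambda>t. Cl2 (2 * t)) \<longlongrightarrow> Cl2 (2 * 0)) (at_right 0)"
      by (intro right[of "\<lambda>t. Cl2 (2 * t)"] isCont_o2[where f = "\<lambda>t. 2 * t" and g = Cl2]) auto
    have "isCont Cl3 x" for x
      by (rule DERIV_isCont[OF has_field_derivative_Cl3])
    then show "((\<lambda>t. Cl3 (2 * t)) \<longlongrightarrow> Cl3 (2 * 0)) (at_right 0)"
      by (intro right[of "\<lambda>t. Cl3 (2 * t)"] isCont_o2[where f = "\<lambda>t. 2 * t" and g = Cl3]) auto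
    have "isCont (\<lambda>u. \<Sum>n. cb_coeff3 n * u ^ n) ((sin 0)\<^sup>2)"
      by (rule DERIV_isCont[OF has_field_derivative_bounded_powser[of _ cb_coeff3, OF _ cb_coeff3_bound]]) simp
    then have "isCont F 0"
      unfolding F_def
      by (intro isCont_o2[where f = "\<lambda>t. (sin t)\<^sup>2" and g = "\<lambda>u. \<Sum>n. cb_coeff3 n * u ^ n"]) auto
    then show "(F \<longlongrightarrow> F 0) (at_right 0)" by (rule right)
  qed (rule tendsto_ident_at)
  moreover have "F 0 = 0"
  proof -
    have "(\<lambda>n. cb_coeff3 n * ((sin 0)\<^sup>2) ^ n) = (\<lambda>n. 0)"
      by (auto simp: cb_coeff3_def fun_eq_iff power_0_left)
    then show ?thesis by (simp add: F_def)
  qed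
  moreover have "(D \<longlongrightarrow> c) (at_right 0)"
  proof (rule tendsto_eventually)
    have "\<forall>\<^sub>F x in at_right 0. x \<in> {0<..<pi / 2}" by (rule eventually_at_right_real) simp
    then show "\<forall>\<^sub>F x in at_right 0. D x = c" by eventually_elim (rule c)
  qed
  ultimately have "c = 2 * Cl3 0"
    using tendsto_unique[OF trivial_limit_at_right_real] by fastforce
  moreover have "D t = c" using t by (intro c) auto
  ultimately show ?thesis by (simp add: D_def F_def)
qed

text \<open>The powers of 4 in the coefficients combine with those of (sin t)^2. The form with
  \<open>sums\<close> allows finitely many values of t to be added termwise.\<close>

lemma sums_central_binomial_cubed:
  assumes t: "0 < t" "t < pi / 2"
  shows "(\<lambda>n. (2 * sin t) ^ (2 * Suc n) / (real ((2 * Suc n) choose Suc n) * real (Suc n) ^ 3)) sums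
     (4 * t\<^sup>2 * ln (2 * sin t) + 4 * t * Cl2 (2 * t) + 2 * Cl3 (2 * t) - 2 * Cl3 0)"
proof -
  have "\<bar>(sin t)\<^sup>2\<bar> < 1" using t by (intro sin_squared_less_1) auto
  then have "(\<lambda>n. cb_coeff3 n * ((sin t)\<^sup>2) ^ n) sums
      (4 * t\<^sup>2 * ln (2 * sin t) + 4 * t * Cl2 (2 * t) + 2 * Cl3 (2 * t) - 2 * Cl3 0)"
    using summable_cb_coeff[OF _ cb_coeff3_bound] cb_series_3[OF t] by (simp add: sums_iff)
  then have "(\<lambda>n. cb_coeff3 (Suc n) * ((sin t)\<^sup>2) ^ Suc n) sums
      (4 * t\<^sup>2 * ln (2 * sin t) + 4 * t * Cl2 (2 * t) + 2 * Cl3 (2 * t) - 2 * Cl3 0)"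
    by (subst sums_Suc_iff) (simp add: cb_coeff3_def cb_coeff2_def)
  moreover have "cb_coeff3 (Suc n) * ((sin t)\<^sup>2) ^ Suc n
      = (2 * sin t) ^ (2 * Suc n) / (real ((2 * Suc n) choose Suc n) * real (Suc n) ^ 3)" for n
  proof -
    have "(2 * sin t) ^ (2 * Suc n) = 4 ^ Suc n * ((sin t)\<^sup>2) ^ Suc n"
      by (simp only: power_mult power_mult_distrib) simp
    then show ?thesis
      by (simp add: cb_coeff3_def cb_coeff2_def cb_coeff_def power3_eq_cube mult_ac
            del: of_nat_Suc power_Suc mult_Suc_right binomial_Suc_Suc)
  qed
  ultimately show ?thesis by simp
qed

section \<open>Expansion in Dirichlet L-functions\<close>

text \<open>Every \<open>k\<close> therefore lies in the gcd class of exactly one divisor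
  \<open>d\<close>, which is how a series over \<open>k\<close> splits.\<close>

lemma gcd_eq_div_iff:
  fixes m :: nat
  assumes "m > 0" "d dvd m"
  shows "gcd k m = m div d \<longleftrightarrow> d = m div gcd k m"
proof -
  obtain q e where q: "m = gcd k m * q" and e: "m = d * e"
    using assms(2) by (metis dvdE gcd_dvd2)
  have pos: "gcd k m > 0" "d > 0" using assms e by auto
  have "m div d = e" using e pos(2) by (metis nonzero_mult_div_cancel_left less_irrefl)
  moreover have "m div gcd k m = q" using q pos(1) by (metis nonzero_mult_div_cancel_left less_irrefl)
  moreover have "gcd k m = e \<longleftrightarrow> d = q"
    using q e pos by (metis mult.commute mult_cancel1 less_irrefl)
  ultimately show ?thesis by simp
qed

text \<open>The integers with gcd(k, m) = m/d are the multiples of m/d whose cofactor is coprime to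
  \<open>d\<close>; taking (m/d)^s out of the denominator gives the weight (d/m)^s.\<close>

lemma suminf_over_gcd:
  fixes g :: "int \<Rightarrow> complex"
  assumes m: "m > 0" and s: "s \<ge> 2" and g: "\<And>k. norm (g k) \<le> 1"
  shows "(\<Sum>k. g (int (Suc k)) / of_nat (Suc k) ^ s)
    = (\<Sum>d | d dvd m. (of_nat d / of_nat m) ^ s *
        (\<Sum>k. (if coprime (int (Suc k)) (int d) then g (int (m div d) * int (Suc k)) else 0) / of_nat (Suc k) ^ s))"
proof -
  have part: "(\<lambda>k. (if gcd (Suc k) m = m div d then g (int (Suc k)) else 0) / of_nat (Suc k) ^ s) sums
      ((of_nat d / of_nat m) ^ s *
        (\<Sum>k. (if coprime (int (Suc k)) (int d) then g (int (m div d) * int (Suc k)) else 0) / of_nat (Suc k) ^ s))"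
    if d: "d dvd m" for d
  proof -
    define q where "q = m div d"
    have qd: "m = q * d" "q > 0" "d > 0" using d m by (auto simp: q_def)
    \<comment> \<open>Terms are indexed from 0 but arguments start at 1, so \<open>h n\<close> is
      the index with \<open>Suc (h n) = q * Suc n\<close>.\<close>
    define h where "h n = q * Suc n - 1" for n
    have Suc_h: "Suc (h n) = q * Suc n" for n using qd(2) by (simp add: h_def)
    have "h n < h (Suc n)" for n
    proof -
      have "Suc (h n) < Suc (h (Suc n))" unfolding Suc_h using qd(2) by simp
      then show ?thesis by simp
    qed
    then have "strict_mono h" by (simp add: strict_mono_Suc_iff)
    let ?f = "\<lambda>k. (if gcd (Suc k) m = m div d then g (int (Suc k)) else 0) / of_nat (Suc k) ^ s"
    let ?t = "\<lambda>k. (if coprime (int (Suc k)) (int d) then g (int q * int (Suc k)) else 0) / of_nat (Suc k) ^ s"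
    have "summable ?t"
      by (rule summable_bounded_over_power[OF s]) (use g in auto)
    then have "(\<lambda>k. (of_nat d / of_nat m) ^ s * ?t k) sums ((of_nat d / of_nat m) ^ s * suminf ?t)"
      by (intro sums_mult summable_sums)
    moreover have "(of_nat d / of_nat m) ^ s * ?t k = ?f (h k)" for k
    proof -
      have "gcd (Suc (h k)) m = q * gcd (Suc k) d"
        unfolding Suc_h qd(1) by (rule gcd_mult_distrib_nat[symmetric])
      moreover have "q * gcd (Suc k) d = m div d \<longleftrightarrow> gcd (Suc k) d = 1"
        unfolding q_def[symmetric] using qd(2) by auto
      ultimately have gcd: "gcd (Suc (h k)) m = m div d \<longleftrightarrow> coprime (int (Suc k)) (int d)"
        unfolding coprime_int_iff by (simp only: coprime_iff_gcd_eq_1)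
      have frac: "of_nat d / of_nat m = 1 / (of_nat q :: complex)"
        using qd by (simp add: field_simps)
      have Suc_h_eq: "of_nat (Suc (h k)) = (of_nat q * of_nat (Suc k) :: complex)" "int (Suc (h k)) = int q * int (Suc k)"
        unfolding Suc_h by (rule of_nat_mult)+
      show ?thesis
        unfolding gcd frac Suc_h_eq by (simp add: power_mult_distrib power_divide del: of_nat_Suc)
    qed
    ultimately have "(\<lambda>k. ?f (h k)) sums ((of_nat d / of_nat m) ^ s * suminf ?t)" by simp
    moreover have zero: "?f n = 0" if "n \<notin> range h" for n
    proof -
      have "gcd (Suc n) m \<noteq> q"
      proof
        assume "gcd (Suc n) m = q"
        then obtain j where j: "Suc n = q * j" by (metis dvdE gcd_dvd1)
        then have "j > 0" using gr0I by fastforce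
        then obtain i where "j = Suc i" using gr0_implies_Suc by blast
        then have "n = h i" using j by (simp add: h_def)
        then show False using that by blast
      qed
      then show ?thesis by (simp add: q_def)
    qed
    ultimately show ?thesis
      unfolding q_def using sums_mono_reindex[OF \<open>strict_mono h\<close>, of ?f, OF zero] by blast
  qed
  have "(\<lambda>k. \<Sum>d | d dvd m. (if gcd (Suc k) m = m div d then g (int (Suc k)) else 0) / of_nat (Suc k) ^ s) sums
      (\<Sum>d | d dvd m. (of_nat d / of_nat m) ^ s *
        (\<Sum>k. (if coprime (int (Suc k)) (int d) then g (int (m div d) * int (Suc k)) else 0) / of_nat (Suc k) ^ s))"
    by (rule sums_sum) (use part in auto)
  moreover have "(\<Sum>d | d dvd m. (if gcd (Suc k) m = m div d then g (int (Suc k)) else 0) / of_nat (Suc k) ^ s)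
      = g (int (Suc k)) / of_nat (Suc k) ^ s" for k
  proof -
    have "(\<Sum>d | d dvd m. (if gcd (Suc k) m = m div d then g (int (Suc k)) else 0) / of_nat (Suc k) ^ s)
        = (\<Sum>d | d dvd m. if d = m div gcd (Suc k) m then g (int (Suc k)) / of_nat (Suc k) ^ s else 0)"
      using gcd_eq_div_iff[OF m] by (intro sum.cong) auto
    also have "\<dots> = g (int (Suc k)) / of_nat (Suc k) ^ s"
    proof -
      have "m div gcd (Suc k) m dvd m"
        by (rule div_dvd_iff_mult[THEN iffD2]) (use m in auto)
      then show ?thesis using m by (subst sum.delta) (simp_all add: finite_divisors_nat)
    qed
    finally show ?thesis .
  qed
  ultimately show ?thesis by (simp add: sums_iff)
qed

lemma suminf_dirichlet_char_combination:
  assumes X: "X \<subseteq> dirichlet_chars d" and s: "s \<ge> 2"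
  shows "(\<Sum>k. (c * (\<Sum>\<theta>\<in>X. t \<theta> * \<theta> (a * int (Suc k)))) / of_nat (Suc k) ^ s)
      = c * (\<Sum>\<theta>\<in>X. t \<theta> * \<theta> a * dirichlet_L \<theta> s)"
proof -
  have "(\<lambda>k. c * (\<Sum>\<theta>\<in>X. t \<theta> * \<theta> a * (\<theta> (int (Suc k)) / of_nat (Suc k) ^ s))) sums
      (c * (\<Sum>\<theta>\<in>X. t \<theta> * \<theta> a * dirichlet_L \<theta> s))"
  proof (intro sums_mult sums_sum)
    fix \<theta> assume "\<theta> \<in> X"
    then have "dirichlet_char d \<theta>" using X by blast
    then show "(\<lambda>k. \<theta> (int (Suc k)) / of_nat (Suc k) ^ s) sums dirichlet_L \<theta> s"
      unfolding dirichlet_L_def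
      by (intro summable_sums summable_bounded_over_power[OF s] norm_dirichlet_char_le)
  qed
  moreover have "c * (\<Sum>\<theta>\<in>X. t \<theta> * \<theta> a * (\<theta> (int (Suc k)) / of_nat (Suc k) ^ s))
      = (c * (\<Sum>\<theta>\<in>X. t \<theta> * \<theta> (a * int (Suc k)))) / of_nat (Suc k) ^ s" for k
  proof -
    have "(\<Sum>\<theta>\<in>X. t \<theta> * \<theta> a * (\<theta> (int (Suc k)) / of_nat (Suc k) ^ s))
        = (\<Sum>\<theta>\<in>X. t \<theta> * \<theta> (a * int (Suc k)) / of_nat (Suc k) ^ s)"
    proof (rule sum.cong)
      fix \<theta> assume "\<theta> \<in> X"
      then have "dirichlet_char d \<theta>" using X by blast
      then show "t \<theta> * \<theta> a * (\<theta> (int (Suc k)) / of_nat (Suc k) ^ s) = t \<theta> * \<theta> (a * int (Suc k)) / of_nat (Suc k) ^ s"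
        by (simp add: dirichlet_char_mult)
    qed simp
    then show ?thesis by (simp only: sum_divide_distrib[symmetric] times_divide_eq_right)
  qed
  ultimately show ?thesis by (simp only: sums_iff)
qed

lemma dirichlet_char_uminus:
  assumes "dirichlet_char d \<theta>"
  shows "\<theta> (- n) = \<theta> (-1) * \<theta> n" and "\<theta> (-1) = 1 \<or> \<theta> (-1) = -1"
  using dirichlet_char_mult[OF assms, of "-1" n] dirichlet_char_mult[OF assms, of "-1" "-1"] dirichlet_char_1[OF assms]
  by (auto simp: square_eq_1_iff)

text \<open>Replacing n by -n flips the sign of exactly the odd characters. Half the difference of
  the two expansions isolates them together with i sin; half the sum isolates the even ones with
  cos.\<close>

lemma sum_gauss_sum_odd_even:
  assumes "d > 0"
  shows "(if coprime n (int d) then of_real (sin (2 * pi * n / d)) else 0)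
      = 1 / (\<i> * of_nat (totient d)) * (\<Sum>\<theta> | dirichlet_char d \<theta> \<and> odd_char \<theta>. gauss_sum d (\<lambda>a. cnj (\<theta> a)) * \<theta> n)"
    (is "?odd")
    and "(if coprime n (int d) then of_real (cos (2 * pi * n / d)) else 0)
      = 1 / of_nat (totient d) * (\<Sum>\<theta> | dirichlet_char d \<theta> \<and> even_char \<theta>. gauss_sum d (\<lambda>a. cnj (\<theta> a)) * \<theta> n)"
    (is "?even")
proof -
  let ?t = "\<lambda>\<theta>. gauss_sum d (\<lambda>a. cnj (\<theta> a))"
  define S where "S n = (\<Sum>\<theta>\<in>dirichlet_chars d. ?t \<theta> * \<theta> n)" for n
  have S: "S n = (if coprime n (int d) then of_nat (totient d) * add_char d n else 0)" for n
    unfolding S_def by (rule sum_gauss_sum_dirichlet_chars[OF assms])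
  have tot: "totient d > 0" using assms by simp
  have "S n - S (- n) = (\<Sum>\<theta>\<in>dirichlet_chars d. if odd_char \<theta> then 2 * (?t \<theta> * \<theta> n) else 0)"
    unfolding S_def sum_subtractf[symmetric]
  proof (intro sum.cong refl)
    fix \<theta> assume "\<theta> \<in> dirichlet_chars d"
    then show "?t \<theta> * \<theta> n - ?t \<theta> * \<theta> (- n) = (if odd_char \<theta> then 2 * (?t \<theta> * \<theta> n) else 0)"
      using dirichlet_char_uminus(1)[of d \<theta> n] dirichlet_char_uminus(2)[of d \<theta>] by (auto simp: odd_char_def)
  qed
  also have "\<dots> = 2 * (\<Sum>\<theta> | dirichlet_char d \<theta> \<and> odd_char \<theta>. ?t \<theta> * \<theta> n)"
    using finite_dirichlet_chars[of d] by (simp add: sum.If_cases Int_def sum_distrib_left)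
  finally have odd: "S n - S (- n) = \<dots>" .
  have "S n + S (- n) = (\<Sum>\<theta>\<in>dirichlet_chars d. if even_char \<theta> then 2 * (?t \<theta> * \<theta> n) else 0)"
    unfolding S_def sum.distrib[symmetric]
  proof (intro sum.cong refl)
    fix \<theta> assume "\<theta> \<in> dirichlet_chars d"
    then show "?t \<theta> * \<theta> n + ?t \<theta> * \<theta> (- n) = (if even_char \<theta> then 2 * (?t \<theta> * \<theta> n) else 0)"
      using dirichlet_char_uminus(1)[of d \<theta> n] dirichlet_char_uminus(2)[of d \<theta>] by (auto simp: even_char_def)
  qed
  also have "\<dots> = 2 * (\<Sum>\<theta> | dirichlet_char d \<theta> \<and> even_char \<theta>. ?t \<theta> * \<theta> n)"
    using finite_dirichlet_chars[of d] by (simp add: sum.If_cases Int_def sum_distrib_left)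
  finally have even: "S n + S (- n) = \<dots>" .
  have "add_char d n - add_char d (- n) = 2 * (\<i> * of_real (sin (2 * pi * n / d)))"
    "add_char d n + add_char d (- n) = 2 * of_real (cos (2 * pi * n / d))"
    by (simp_all add: add_char_def complex_eq_iff)
  then have "S n - S (- n) = (if coprime n (int d) then 2 * (\<i> * of_nat (totient d) * of_real (sin (2 * pi * n / d))) else 0)"
    "S n + S (- n) = (if coprime n (int d) then 2 * (of_nat (totient d) * of_real (cos (2 * pi * n / d))) else 0)"
    unfolding S by (simp_all flip: right_diff_distrib distrib_left)
  then show ?odd ?even
    using tot unfolding odd even by (auto simp: field_simps)
qed

text \<open>The common core of the sine and cosine cases. By \<open>eq\<close>, the coprime part of
  \<open>g\<close> on multiples of m/d is a combination of characters modulo \<open>d\<close> at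
  \<open>a * k\<close>; multiplicativity separates \<open>\<theta> a\<close> from the
  L-series.\<close>

lemma twisted_series_eq_sum_dirichlet_L:
  fixes g :: "int \<Rightarrow> complex"
  assumes m: "m > 0" and s: "s \<ge> 2" and g: "\<And>k. norm (g k) \<le> 1"
    and X: "\<And>d. X d \<subseteq> dirichlet_chars d"
    and eq: "\<And>d k. d dvd m \<Longrightarrow> (if coprime k (int d) then g (int (m div d) * k) else 0)
        = c d * (\<Sum>\<theta>\<in>X d. t d \<theta> * \<theta> (a * k))"
  shows "of_nat m ^ s * (\<Sum>k. g (int (Suc k)) / of_nat (Suc k) ^ s)
     = (\<Sum>d | d dvd m. of_nat d ^ s * c d * (\<Sum>\<theta>\<in>X d. t d \<theta> * \<theta> a * dirichlet_L \<theta> s))"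
proof -
  have "(\<Sum>k. g (int (Suc k)) / of_nat (Suc k) ^ s)
     = (\<Sum>d | d dvd m. (of_nat d / of_nat m) ^ s * (c d * (\<Sum>\<theta>\<in>X d. t d \<theta> * \<theta> a * dirichlet_L \<theta> s)))"
    unfolding suminf_over_gcd[OF m s, of g, OF g]
    by (intro sum.cong refl) (simp only: mem_Collect_eq eq suminf_dirichlet_char_combination[OF X s])
  then show ?thesis
    using m by (simp add: sum_distrib_left power_divide mult_ac)
qed

lemma Cl_eq_sum_dirichlet_L:
  assumes m: "m > 0" and a: "coprime a (int m)"
  shows "of_nat m ^ 2 * (\<i> * of_real (Cl2 (2 * pi * a / m))) = (\<Sum>d | d dvd m. of_nat d ^ 2 / of_nat (totient d) *
      (\<Sum>\<theta> | dirichlet_char d \<theta> \<and> odd_char \<theta>. \<theta> a * gauss_sum d (\<lambda>a. cnj (\<theta> a)) * dirichlet_L \<theta> 2))"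
    and "of_nat m ^ 3 * of_real (Cl3 (2 * pi * a / m)) = (\<Sum>d | d dvd m. of_nat d ^ 3 / of_nat (totient d) *
      (\<Sum>\<theta> | dirichlet_char d \<theta> \<and> even_char \<theta>. \<theta> a * gauss_sum d (\<lambda>a. cnj (\<theta> a)) * dirichlet_L \<theta> 3))"
proof -
  \<comment> \<open>\<open>a\<close> is a unit modulo every divisor of \<open>m\<close>, so the
    condition on \<open>k\<close> can be read as one on \<open>a * k\<close>, where the character
    expansion applies.\<close>
  have cop: "coprime (a * k) (int d) \<longleftrightarrow> coprime k (int d)" if "d dvd m" for d k
    using a that by (metis coprime_divisors coprime_mult_left_iff dvd_refl int_dvd_int_iff)
  have arg: "2 * pi * a * real_of_int (int (m div d) * k) / m = 2 * pi * real_of_int (a * k) / d" if "d dvd m" for d k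
    using that m by (auto elim!: dvdE simp: field_simps)
  have "of_nat m ^ 2 * (\<Sum>k. of_real (sin (2 * pi * a * real_of_int (int (Suc k)) / m)) / of_nat (Suc k) ^ 2)
      = (\<Sum>d | d dvd m. of_nat d ^ 2 * (1 / (\<i> * of_nat (totient d))) *
      (\<Sum>\<theta> | dirichlet_char d \<theta> \<and> odd_char \<theta>. gauss_sum d (\<lambda>a. cnj (\<theta> a)) * \<theta> a * dirichlet_L \<theta> 2))"
  proof (rule twisted_series_eq_sum_dirichlet_L[OF m])
    fix d k assume "d dvd m"
    then have "d > 0" using m by (auto intro!: Nat.gr0I)
    from sum_gauss_sum_odd_even(1)[OF this, of "a * k"]
    show "(if coprime k (int d) then of_real (sin (2 * pi * a * real_of_int (int (m div d) * k) / m)) else 0)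
       = 1 / (\<i> * of_nat (totient d)) * (\<Sum>\<theta> | dirichlet_char d \<theta> \<and> odd_char \<theta>. gauss_sum d (\<lambda>a. cnj (\<theta> a)) * \<theta> (a * k))"
      unfolding cop[OF \<open>d dvd m\<close>] arg[OF \<open>d dvd m\<close>] .
  qed auto
  moreover have "(\<Sum>k. of_real (sin (2 * pi * a * real_of_int (int (Suc k)) / m)) / of_nat (Suc k) ^ 2) = complex_of_real (Cl2 (2 * pi * a / m))"
  proof -
    have "summable (\<lambda>k. sin (real (Suc k) * (2 * pi * a / m)) / of_nat (Suc k) ^ 2)"
      by (rule summable_bounded_over_power) auto
    from suminf_of_real[OF this, where 'a = complex] show ?thesis
      unfolding Cl2_def by (simp add: mult_ac del: of_nat_Suc)
  qed
  ultimately show "of_nat m ^ 2 * (\<i> * of_real (Cl2 (2 * pi * a / m))) = (\<Sum>d | d dvd m. of_nat d ^ 2 / of_nat (totient d) *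
      (\<Sum>\<theta> | dirichlet_char d \<theta> \<and> odd_char \<theta>. \<theta> a * gauss_sum d (\<lambda>a. cnj (\<theta> a)) * dirichlet_L \<theta> 2))"
    by (simp add: mult.left_commute[of _ \<i>] sum_distrib_left mult_ac)
  have "of_nat m ^ 3 * (\<Sum>k. of_real (cos (2 * pi * a * real_of_int (int (Suc k)) / m)) / of_nat (Suc k) ^ 3)
      = (\<Sum>d | d dvd m. of_nat d ^ 3 * (1 / of_nat (totient d)) *
      (\<Sum>\<theta> | dirichlet_char d \<theta> \<and> even_char \<theta>. gauss_sum d (\<lambda>a. cnj (\<theta> a)) * \<theta> a * dirichlet_L \<theta> 3))"
  proof (rule twisted_series_eq_sum_dirichlet_L[OF m])
    fix d k assume "d dvd m"
    then have "d > 0" using m by (auto intro!: Nat.gr0I)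
    from sum_gauss_sum_odd_even(2)[OF this, of "a * k"]
    show "(if coprime k (int d) then of_real (cos (2 * pi * a * real_of_int (int (m div d) * k) / m)) else 0)
       = 1 / of_nat (totient d) * (\<Sum>\<theta> | dirichlet_char d \<theta> \<and> even_char \<theta>. gauss_sum d (\<lambda>a. cnj (\<theta> a)) * \<theta> (a * k))"
      unfolding cop[OF \<open>d dvd m\<close>] arg[OF \<open>d dvd m\<close>] .
  qed auto
  moreover have "(\<Sum>k. of_real (cos (2 * pi * a * real_of_int (int (Suc k)) / m)) / of_nat (Suc k) ^ 3) = complex_of_real (Cl3 (2 * pi * a / m))"
  proof -
    have "summable (\<lambda>k. cos (real (Suc k) * (2 * pi * a / m)) / of_nat (Suc k) ^ 3)"
      by (rule summable_bounded_over_power) auto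
    from suminf_of_real[OF this, where 'a = complex] show ?thesis
      unfolding Cl3_def by (simp add: mult_ac del: of_nat_Suc)
  qed
  ultimately show "of_nat m ^ 3 * of_real (Cl3 (2 * pi * a / m)) = (\<Sum>d | d dvd m. of_nat d ^ 3 / of_nat (totient d) *
      (\<Sum>\<theta> | dirichlet_char d \<theta> \<and> even_char \<theta>. \<theta> a * gauss_sum d (\<lambda>a. cnj (\<theta> a)) * dirichlet_L \<theta> 3))"
    by (simp add: mult_ac)
qed

section \<open>The formula for the value at 1\<close>

lemma zeta3_eq_Cl3: "zeta3 = of_real (Cl3 0)"
proof -
  have "summable (\<lambda>k. cos (real (Suc k) * 0) / of_nat (Suc k) ^ 3)"
    by (rule summable_bounded_over_power) auto
  from suminf_of_real[OF this, where 'a = complex] show ?thesis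
    unfolding Cl3_def zeta3_def by simp
qed

text \<open>The sum over a is finite, so the conditionally convergent cosine series may be summed
  for each a separately; 2 a < m puts 2 pi a/m in the range where the log-sine series holds.\<close>

lemma dirichlet_L_1_even:
  assumes "m > 1" "primitive_char m \<psi>" "even_char \<psi>"
  shows "dirichlet_L \<psi> 1 = - (2 * gauss_sum m \<psi> / of_nat m) *
    (\<Sum>a | 0 < a \<and> 2 * a < int m. cnj (\<psi> a) * of_real (ln (2 * sin (pi * a / m))))"
proof -
  let ?H = "{a. 0 < a \<and> 2 * a < int m}"
  have "(\<lambda>k. 2 * gauss_sum m \<psi> / of_nat m *
      (\<Sum>a\<in>?H. cnj (\<psi> a) * of_real (cos (real (Suc k) * (2 * pi * a / m)) / real (Suc k)))) sums
      (2 * gauss_sum m \<psi> / of_nat m * (\<Sum>a\<in>?H. cnj (\<psi> a) * of_real (- ln (2 * sin (2 * pi * a / m / 2)))))"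
  proof (intro sums_mult sums_sum sums_of_real sums_cos_over_n)
    fix a assume a: "a \<in> ?H"
    then show "0 < 2 * pi * real_of_int a / real m" by simp
    have "2 * real_of_int a \<le> real m" using a by simp
    then show "2 * pi * real_of_int a / real m \<le> pi"
      using assms(1) by (simp add: field_simps mult_left_mono)
  qed
  moreover have "2 * gauss_sum m \<psi> / of_nat m *
      (\<Sum>a\<in>?H. cnj (\<psi> a) * of_real (cos (real (Suc k) * (2 * pi * a / m)) / real (Suc k)))
      = \<psi> (int (Suc k)) / of_nat (Suc k) ^ 1" for k
  proof -
    have "\<psi> (int (Suc k)) = 2 * gauss_sum m \<psi> / of_nat m *
      (\<Sum>a\<in>?H. cnj (\<psi> a) * of_real (cos (2 * pi * a * int (Suc k) / m)))"
      using primitive_even_char_eq_sum_cos[OF assms, of "int (Suc k)"] assms(1)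
      by (simp add: field_simps del: of_nat_Suc)
    moreover have "(\<Sum>a\<in>?H. cnj (\<psi> a) * of_real (cos (real (Suc k) * (2 * pi * a / m)) / real (Suc k)))
      = (\<Sum>a\<in>?H. cnj (\<psi> a) * of_real (cos (2 * pi * a * int (Suc k) / m))) / of_nat (Suc k)"
      by (simp add: sum_divide_distrib mult_ac del: of_nat_Suc)
    ultimately show ?thesis
      by (simp del: of_nat_Suc)
  qed
  ultimately show ?thesis
    unfolding dirichlet_L_def by (simp add: sums_iff sum_negf)
qed

theorem theorem1:
  fixes m :: nat and \<psi> :: "int \<Rightarrow> complex"
  assumes "m > 1"
    and "primitive_char m \<psi>"
    and "even_char \<psi>"
  shows "dirichlet_L \<psi> 1 =
      2 * gauss_sum m \<psi> / (of_real pi * \<i> * of_nat m ^ 2) *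
        (\<Sum>d\<in>{d. d dvd m}. of_nat d ^ 2 / of_nat (totient d) *
          (\<Sum>\<theta>\<in>{\<theta>. dirichlet_char d \<theta> \<and> odd_char \<theta>}.
             Bsum m (-1) (\<lambda>a. \<theta> a * cnj (\<psi> a)) * gauss_sum d (\<lambda>a. cnj (\<theta> a)) *
             dirichlet_L \<theta> 2))
    + gauss_sum m \<psi> / (of_real (pi ^ 2) * of_nat m ^ 2) *
        (\<Sum>d\<in>{d. d dvd m}. of_nat d ^ 3 / of_nat (totient d) *
          (\<Sum>\<theta>\<in>{\<theta>. dirichlet_char d \<theta> \<and> even_char \<theta>}.
             Bsum m (-2) (\<lambda>a. \<theta> a * cnj (\<psi> a)) * gauss_sum d (\<lambda>a. cnj (\<theta> a)) *
             dirichlet_L \<theta> 3))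
    - of_nat m * gauss_sum m \<psi> / of_real (pi ^ 2) * Bsum m (-2) (\<lambda>a. cnj (\<psi> a)) * zeta3
    - of_nat m * gauss_sum m \<psi> / (2 * of_real (pi ^ 2)) *
        (\<Sum>n. 1 / (of_nat ((2 * Suc n) choose Suc n) * of_nat (Suc n) ^ 3) *
          (\<Sum>a\<in>{a::int. 0 < a \<and> 2 * a < int m}.
             cnj (\<psi> a) / of_int a ^ 2 * of_real ((2 * sin (pi * of_int a / of_nat m)) ^ (2 * Suc n))))"
proof -
  have char: "dirichlet_char m \<psi>" using assms(2) by (simp add: primitive_char_def)
  have m: "m > 0" using assms(1) by simp
  define H where "H = {a::int. 0 < a \<and> 2 * a < int m}"
  define \<tau> where "\<tau> = gauss_sum m \<psi>"
  define S1 where "S1 = (\<Sum>a\<in>H. cnj (\<psi> a) * of_real (ln (2 * sin (pi * a / m))))"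
  define S2 where "S2 = (\<Sum>a\<in>H. cnj (\<psi> a) / of_int a * of_real (Cl2 (2 * pi * a / m)))"
  define S3 where "S3 = (\<Sum>a\<in>H. cnj (\<psi> a) / of_int a ^ 2 * of_real (Cl3 (2 * pi * a / m)))"
  define B where "B = Bsum m (-2) (\<lambda>a. cnj (\<psi> a))"
  have B: "B = (\<Sum>a\<in>H. cnj (\<psi> a) / of_int a ^ 2)"
    by (simp add: B_def Bsum_def H_def power_int_minus divide_inverse mult_ac)
  \<comment> \<open>Moving the sum over a outside reduces to the expansion at a fixed a, assumed for
    a coprime to \<open>m\<close>; at every other a the weight \<open>\<psi> a\<close> is 0.\<close>
  have interchange: "(\<Sum>d | d dvd m. w d * (\<Sum>\<theta>\<in>X d. Bsum m (- int j) (\<lambda>a. \<theta> a * cnj (\<psi> a)) * t d \<theta> * l \<theta>))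
      = (\<Sum>a\<in>H. cnj (\<psi> a) / of_int a ^ j * v a)"
    if v: "\<And>a. coprime a (int m) \<Longrightarrow> v a = (\<Sum>d | d dvd m. w d * (\<Sum>\<theta>\<in>X d. \<theta> a * t d \<theta> * l \<theta>))"
    for w X t l v j
  proof -
    have "Bsum m (- int j) (\<lambda>a. \<theta> a * cnj (\<psi> a)) = (\<Sum>a\<in>H. cnj (\<psi> a) / of_int a ^ j * \<theta> a)" for \<theta>
      by (simp add: Bsum_def H_def power_int_minus divide_inverse mult_ac)
    then have "(\<Sum>d | d dvd m. w d * (\<Sum>\<theta>\<in>X d. Bsum m (- int j) (\<lambda>a. \<theta> a * cnj (\<psi> a)) * t d \<theta> * l \<theta>))
       = (\<Sum>d | d dvd m. \<Sum>\<theta>\<in>X d. \<Sum>a\<in>H. cnj (\<psi> a) / of_int a ^ j * (w d * (\<theta> a * t d \<theta> * l \<theta>)))"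
      by (simp add: sum_distrib_left sum_distrib_right mult_ac)
    also have "\<dots> = (\<Sum>d | d dvd m. \<Sum>a\<in>H. \<Sum>\<theta>\<in>X d. cnj (\<psi> a) / of_int a ^ j * (w d * (\<theta> a * t d \<theta> * l \<theta>)))"
      by (intro sum.cong refl sum.swap)
    also have "\<dots> = (\<Sum>a\<in>H. \<Sum>d | d dvd m. \<Sum>\<theta>\<in>X d. cnj (\<psi> a) / of_int a ^ j * (w d * (\<theta> a * t d \<theta> * l \<theta>)))"
      by (rule sum.swap)
    also have "\<dots> = (\<Sum>a\<in>H. cnj (\<psi> a) / of_int a ^ j * v a)"
    proof (rule sum.cong)
      fix a
      show "(\<Sum>d | d dvd m. \<Sum>\<theta>\<in>X d. cnj (\<psi> a) / of_int a ^ j * (w d * (\<theta> a * t d \<theta> * l \<theta>)))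
         = cnj (\<psi> a) / of_int a ^ j * v a"
      proof (cases "coprime a (int m)")
        case True
        show ?thesis unfolding v[OF True] sum_distrib_left ..
      next
        case False
        then have "\<psi> a = 0" by (simp add: dirichlet_char_eq_0_iff[OF char])
        then show ?thesis by simp
      qed
    qed simp
    finally show ?thesis .
  qed
  have odd: "(\<Sum>d\<in>{d. d dvd m}. of_nat d ^ 2 / of_nat (totient d) *
          (\<Sum>\<theta>\<in>{\<theta>. dirichlet_char d \<theta> \<and> odd_char \<theta>}.
             Bsum m (-1) (\<lambda>a. \<theta> a * cnj (\<psi> a)) * gauss_sum d (\<lambda>a. cnj (\<theta> a)) *
             dirichlet_L \<theta> 2)) = \<i> * of_nat m ^ 2 * S2"
  proof -
    have "of_nat m ^ 2 * (\<i> * of_real (Cl2 (2 * pi * a / m))) = (\<Sum>d | d dvd m. of_nat d ^ 2 / of_nat (totient d) *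
        (\<Sum>\<theta>\<in>{\<theta>. dirichlet_char d \<theta> \<and> odd_char \<theta>}. \<theta> a * gauss_sum d (\<lambda>a. cnj (\<theta> a)) * dirichlet_L \<theta> 2))"
      if "coprime a (int m)" for a
      using Cl_eq_sum_dirichlet_L(1)[OF m that] .
    from interchange[where j = 1, OF this] show ?thesis
      by (simp add: S2_def sum_distrib_left mult_ac)
  qed
  have even: "(\<Sum>d\<in>{d. d dvd m}. of_nat d ^ 3 / of_nat (totient d) *
          (\<Sum>\<theta>\<in>{\<theta>. dirichlet_char d \<theta> \<and> even_char \<theta>}.
             Bsum m (-2) (\<lambda>a. \<theta> a * cnj (\<psi> a)) * gauss_sum d (\<lambda>a. cnj (\<theta> a)) *
             dirichlet_L \<theta> 3)) = of_nat m ^ 3 * S3"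
  proof -
    have "of_nat m ^ 3 * of_real (Cl3 (2 * pi * a / m)) = (\<Sum>d | d dvd m. of_nat d ^ 3 / of_nat (totient d) *
        (\<Sum>\<theta>\<in>{\<theta>. dirichlet_char d \<theta> \<and> even_char \<theta>}. \<theta> a * gauss_sum d (\<lambda>a. cnj (\<theta> a)) * dirichlet_L \<theta> 3))"
      if "coprime a (int m)" for a
      using Cl_eq_sum_dirichlet_L(2)[OF m that] .
    from interchange[where j = 2, OF this] show ?thesis
      by (simp add: S3_def sum_distrib_left mult_ac)
  qed
  have last: "(\<Sum>n. 1 / (of_nat ((2 * Suc n) choose Suc n) * of_nat (Suc n) ^ 3) *
          (\<Sum>a\<in>H. cnj (\<psi> a) / of_int a ^ 2 * of_real ((2 * sin (pi * of_int a / of_nat m)) ^ (2 * Suc n))))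
     = 4 * of_real pi ^ 2 / of_nat m ^ 2 * S1 + 4 * of_real pi / of_nat m * S2 + 2 * S3 - 2 * zeta3 * B"
  proof -
    let ?b = "\<lambda>n. real ((2 * Suc n) choose Suc n) * real (Suc n) ^ 3"
    let ?V = "\<lambda>t. 4 * t\<^sup>2 * ln (2 * sin t) + 4 * t * Cl2 (2 * t) + 2 * Cl3 (2 * t) - 2 * Cl3 0"
    have "(\<lambda>n. \<Sum>a\<in>H. cnj (\<psi> a) / of_int a ^ 2 * of_real ((2 * sin (pi * a / m)) ^ (2 * Suc n) / ?b n))
        sums (\<Sum>a\<in>H. cnj (\<psi> a) / of_int a ^ 2 * of_real (?V (pi * a / m)))"
    proof (intro sums_sum sums_mult sums_of_real sums_central_binomial_cubed)
      fix a assume a: "a \<in> H"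
      then show "0 < pi * real_of_int a / real m" using m by (simp add: H_def)
      have "2 * real_of_int a < real m" using a by (simp add: H_def)
      then show "pi * real_of_int a / real m < pi / 2" using m by (simp add: field_simps)
    qed
    moreover have "(\<Sum>a\<in>H. cnj (\<psi> a) / of_int a ^ 2 * of_real ((2 * sin (pi * a / m)) ^ (2 * Suc n) / ?b n))
        = 1 / (of_nat ((2 * Suc n) choose Suc n) * of_nat (Suc n) ^ 3) *
          (\<Sum>a\<in>H. cnj (\<psi> a) / of_int a ^ 2 * of_real ((2 * sin (pi * of_int a / of_nat m)) ^ (2 * Suc n)))" for n
      by (simp add: sum_distrib_left mult_ac del: of_nat_Suc binomial_Suc_Suc mult_Suc_right power_Suc)
    \<comment> \<open>Division by a^2 turns t^2, t and 1 at t = pi a/m into pi^2/m^2, pi/(m a) and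
      1/a^2.\<close>
    moreover have "(\<Sum>a\<in>H. cnj (\<psi> a) / of_int a ^ 2 * of_real (?V (pi * a / m)))
        = 4 * of_real pi ^ 2 / of_nat m ^ 2 * S1 + 4 * of_real pi / of_nat m * S2 + 2 * S3 - 2 * zeta3 * B"
      unfolding S1_def S2_def S3_def B zeta3_eq_Cl3 sum_distrib_left sum.distrib[symmetric] sum_subtractf[symmetric]
    proof (rule sum.cong)
      fix a assume "a \<in> H"
      then have "a \<noteq> 0" by (simp add: H_def)
      then show "cnj (\<psi> a) / of_int a ^ 2 * of_real (?V (pi * a / m)) =
          4 * of_real pi ^ 2 / of_nat m ^ 2 * (cnj (\<psi> a) * of_real (ln (2 * sin (pi * a / m)))) +
          4 * of_real pi / of_nat m * (cnj (\<psi> a) / of_int a * of_real (Cl2 (2 * pi * a / m))) +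
          2 * (cnj (\<psi> a) / of_int a ^ 2 * of_real (Cl3 (2 * pi * a / m))) -
          2 * of_real (Cl3 0) * (cnj (\<psi> a) / of_int a ^ 2)"
        using m by (simp add: field_simps power2_eq_square)
    qed simp
    ultimately show ?thesis by (simp only: sums_iff)
  qed
  have "dirichlet_L \<psi> 1 = - (2 * \<tau> / of_nat m) * S1"
    using dirichlet_L_1_even[OF assms] by (simp add: \<tau>_def S1_def H_def)
  \<comment> \<open>Multiplying \<open>last\<close> by -m \<tau> / (2 pi^2) turns its
    \<open>S1\<close> term into -(2 \<tau> / m) \<open>S1\<close>, which is
    \<open>dirichlet_L \<psi> 1\<close>; its other three terms cancel against those from
    \<open>odd\<close>, \<open>even\<close> and \<open>zeta3\<close>.\<close>
  then show ?thesis
    unfolding odd even last[unfolded H_def] \<tau>_def[symmetric] B_def[symmetric]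
    using m by (simp add: field_simps power2_eq_square power3_eq_cube)
qed

end
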